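(* Let $G$ be a non-cyclic finite group and let $p$ be the smallest prime number dividing the order of $G$. Then for all $n\ge 1$, $$D^{\wedge}_n(G)\leq\frac{p^{n+1}+p^n-1}{p^{2n+1}},$$ and equality holds if and only if $G/Z^{\wedge}(G)$ is an elementary abelian $p$-group of rank $2$.
   Context: For a group $G$ write ${}^hg=hgh^{-1}$. The tensor square $G\otimes G$ is the group generated by symbols $g\otimes h$ ($g,h\in G$) subject to $gk\otimes h=({}^gk\otimes {}^gh)(g\otimes h)$ and $g\otimes hk=(g\otimes h)({}^hg\otimes {}^hk)$ for all $g,h,k\in G$. The exterior square $G\wedge G$ is the quotient of $G\otimes G$ obtained by imposing the additional relations $g\otimes g=1$ for all $g\in G$; the image of $x\otimes y$ is denoted $x\wedge y$. For $x\in G$, the exterior centralizer is the subgroup $C^{\wedge}_G(x)=\{y\in G: x\wedge y=1\}$, and the exterior center is $Z^{\wedge}(G)=\bigcap_{x\in G}C^{\wedge}_G(x)$. For a finite group $G$ and an integer $n\ge 0$, the multiple exterior degree is $$D^{\wedge}_n(G)=\frac{|\{(x_1,\dots,x_{n+1})\in G^{n+1}: x_i\wedge x_j=1 \text{ in } G\wedge G \text{ for all } 1\le i,j\le n+1\}|}{|G|^{n+1}}.$$ *)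

theory Defs
  imports Complex_Main "HOL-Algebra.Product_Groups" "HOL-Algebra.Generated_Groups" "HOL-Computational_Algebra.Primes"
begin

section \<open>Groups given by generators and relations\<close>

text \<open>
  The library has no free or finitely presented groups. A word over the alphabet \<open>S\<close> is a list of
  letters \<open>(x, b)\<close>, where \<open>(x, True)\<close> stands for the generator \<open>x\<close> and \<open>(x, False)\<close> for its formal
  inverse. A relation \<open>u = v\<close> is the pair \<open>(u, v)\<close>. The group generated by \<open>S\<close> subject to \<open>R\<close>
  consists of the words modulo the least congruence (for concatenation) that contains \<open>R\<close> and
  cancels each letter against its inverse.
\<close>

type_synonym 'x gen_word = "('x \<times> bool) list"

definition gen_words :: "'x set \<Rightarrow> 'x gen_word set"
  where "gen_words S = lists (S \<times> UNIV)"

inductive_set word_cong :: "'x set \<Rightarrow> ('x gen_word \<times> 'x gen_word) set \<Rightarrow> ('x gen_word \<times> 'x gen_word) set"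
  for S :: "'x set" and R :: "('x gen_word \<times> 'x gen_word) set"
  where
    refl: "w \<in> gen_words S \<Longrightarrow> (w, w) \<in> word_cong S R"
  | sym: "(u, v) \<in> word_cong S R \<Longrightarrow> (v, u) \<in> word_cong S R"
  | trans: "(u, v) \<in> word_cong S R \<Longrightarrow> (v, w) \<in> word_cong S R \<Longrightarrow> (u, w) \<in> word_cong S R"
  | append: "(u, u') \<in> word_cong S R \<Longrightarrow> (v, v') \<in> word_cong S R \<Longrightarrow> (u @ v, u' @ v') \<in> word_cong S R"
  | cancel: "x \<in> S \<Longrightarrow> ([(x, b), (x, \<not> b)], []) \<in> word_cong S R"
  | rel: "(u, v) \<in> R \<Longrightarrow> u \<in> gen_words S \<Longrightarrow> v \<in> gen_words S \<Longrightarrow> (u, v) \<in> word_cong S R"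

definition presented_group :: "'x set \<Rightarrow> ('x gen_word \<times> 'x gen_word) set \<Rightarrow> 'x gen_word set monoid"
  where "presented_group S R =
    \<lparr>carrier = gen_words S // word_cong S R,
     monoid.mult = (\<lambda>A B. \<Union>a\<in>A. \<Union>b\<in>B. word_cong S R `` {a @ b}),
     one = word_cong S R `` {[]}\<rparr>"

definition normal_closure :: "('a, 'b) monoid_scheme \<Rightarrow> 'a set \<Rightarrow> 'a set"
  where "normal_closure G S = \<Inter>{N. N \<lhd> G \<and> S \<subseteq> N}"


section \<open>Tensor square and exterior square\<close>

definition conj_by :: "('a, 'b) monoid_scheme \<Rightarrow> 'a \<Rightarrow> 'a \<Rightarrow> 'a"
  where "conj_by G h g = h \<otimes>\<^bsub>G\<^esub> g \<otimes>\<^bsub>G\<^esub> inv\<^bsub>G\<^esub> h"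

definition tensor_rels :: "('a, 'b) monoid_scheme \<Rightarrow> (('a \<times> 'a) gen_word \<times> ('a \<times> 'a) gen_word) set"
  where "tensor_rels G =
    {([((g \<otimes>\<^bsub>G\<^esub> k, h), True)], [((conj_by G g k, conj_by G g h), True), ((g, h), True)]) | g h k.
       g \<in> carrier G \<and> h \<in> carrier G \<and> k \<in> carrier G} \<union>
    {([((g, h \<otimes>\<^bsub>G\<^esub> k), True)], [((g, h), True), ((conj_by G h g, conj_by G h k), True)]) | g h k.
       g \<in> carrier G \<and> h \<in> carrier G \<and> k \<in> carrier G}"

definition tensor_square :: "('a, 'b) monoid_scheme \<Rightarrow> ('a \<times> 'a) gen_word set monoid"
  where "tensor_square G = presented_group (carrier G \<times> carrier G) (tensor_rels G)"

definition tensor :: "('a, 'b) monoid_scheme \<Rightarrow> 'a \<Rightarrow> 'a \<Rightarrow> ('a \<times> 'a) gen_word set"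
  where "tensor G g h = word_cong (carrier G \<times> carrier G) (tensor_rels G) `` {[((g, h), True)]}"

definition diagonal_closure :: "('a, 'b) monoid_scheme \<Rightarrow> ('a \<times> 'a) gen_word set set"
  where "diagonal_closure G = normal_closure (tensor_square G) {tensor G g g | g. g \<in> carrier G}"

definition exterior_square :: "('a, 'b) monoid_scheme \<Rightarrow> ('a \<times> 'a) gen_word set set monoid"
  where "exterior_square G = tensor_square G Mod diagonal_closure G"

definition wedge :: "('a, 'b) monoid_scheme \<Rightarrow> 'a \<Rightarrow> 'a \<Rightarrow> ('a \<times> 'a) gen_word set set"
  where "wedge G x y = diagonal_closure G #>\<^bsub>tensor_square G\<^esub> tensor G x y"

definition exterior_centralizer :: "('a, 'b) monoid_scheme \<Rightarrow> 'a \<Rightarrow> 'a set"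
  where "exterior_centralizer G x = {y \<in> carrier G. wedge G x y = \<one>\<^bsub>exterior_square G\<^esub>}"

definition exterior_center :: "('a, 'b) monoid_scheme \<Rightarrow> 'a set"
  where "exterior_center G = (\<Inter>x\<in>carrier G. exterior_centralizer G x)"

definition multiple_exterior_degree :: "nat \<Rightarrow> ('a, 'b) monoid_scheme \<Rightarrow> real"
  where "multiple_exterior_degree n G =
    real (card {x \<in> {1..n+1} \<rightarrow>\<^sub>E carrier G.
                  \<forall>i\<in>{1..n+1}. \<forall>j\<in>{1..n+1}. wedge G (x i) (x j) = \<one>\<^bsub>exterior_square G\<^esub>})
    / real (card (carrier G)) ^ (n + 1)"

definition elementary_abelian :: "nat \<Rightarrow> nat \<Rightarrow> ('a, 'b) monoid_scheme \<Rightarrow> bool"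
  where "elementary_abelian p r G \<longleftrightarrow> G \<cong> product_group {..<r} (\<lambda>_. integer_mod_group p)"


section \<open>The constructions are groups, and the defining relations hold\<close>

lemma word_cong_words:
  assumes "(u, v) \<in> word_cong S R" shows "u \<in> gen_words S \<and> v \<in> gen_words S"
  using assms by induction (auto simp: gen_words_def)

lemma equiv_word_cong: "equiv (gen_words S) (word_cong S R)"
proof (rule equivI)
  show "word_cong S R \<subseteq> gen_words S \<times> gen_words S"
    using word_cong_words by (intro subrelI) blast
  show "refl_on (gen_words S) (word_cong S R)"
    by (simp add: refl_on_def word_cong.refl)
  show "sym (word_cong S R)"
    using word_cong.sym by (rule symI)
  show "trans (word_cong S R)"
    using word_cong.trans by (rule transI)
qed

lemma mult_presented_group:
  assumes "u \<in> gen_words S" "v \<in> gen_words S"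
  shows "word_cong S R `` {u} \<otimes>\<^bsub>presented_group S R\<^esub> word_cong S R `` {v} = word_cong S R `` {u @ v}"
proof -
  have "word_cong S R `` {a @ b} = word_cong S R `` {u @ v}"
    if "a \<in> word_cong S R `` {u}" "b \<in> word_cong S R `` {v}" for a b
    using that equiv_class_eq[OF equiv_word_cong word_cong.append] by blast
  then have "(\<Union>a\<in>word_cong S R `` {u}. \<Union>b\<in>word_cong S R `` {v}. word_cong S R `` {a @ b})
      = (\<Union>a\<in>word_cong S R `` {u}. \<Union>b\<in>word_cong S R `` {v}. word_cong S R `` {u @ v})"
    by (intro SUP_cong HOL.refl)
  also have "\<dots> = word_cong S R `` {u @ v}"
    using assms word_cong.refl by blast
  finally show ?thesis
    by (simp add: presented_group_def)
qed

lemma carrier_presented_group: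
  "carrier (presented_group S R) = (\<lambda>w. word_cong S R `` {w}) ` gen_words S"
  by (auto simp: presented_group_def quotient_def)

lemma inverse_word_cong:
  assumes "w \<in> gen_words S"
  shows "(rev (map (\<lambda>(x, b). (x, \<not> b)) w) @ w, []) \<in> word_cong S R"
  using assms
proof (induction w)
  case Nil
  then show ?case by (auto intro: word_cong.refl)
next
  case (Cons l w)
  obtain x b where l: "l = (x, b)" by (cases l)
  have x: "x \<in> S" and w: "w \<in> gen_words S"
    using Cons.prems by (auto simp: l gen_words_def)
  let ?r = "rev (map (\<lambda>(x, b). (x, \<not> b)) w)"
  have r: "?r \<in> gen_words S"
    using w by (auto simp: gen_words_def)
  have "([(x, \<not> b), (x, b)], []) \<in> word_cong S R"
    using word_cong.cancel[OF x, of "\<not> b"] by simp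
  from word_cong.append[OF this word_cong.refl[OF w]]
  have "((x, \<not> b) # (x, b) # w, w) \<in> word_cong S R" by simp
  from word_cong.append[OF word_cong.refl[OF r] this]
  have "(?r @ (x, \<not> b) # (x, b) # w, ?r @ w) \<in> word_cong S R" .
  from word_cong.trans[OF this Cons.IH[OF w]]
  show ?case by (simp add: l)
qed

lemma group_presented_group: "group (presented_group S R)"
proof (rule groupI)
  let ?P = "presented_group S R" and ?c = "\<lambda>w. word_cong S R `` {w}"
  have app: "u @ v \<in> gen_words S" if "u \<in> gen_words S" "v \<in> gen_words S" for u v
    using that by (auto simp: gen_words_def)
  have nil: "[] \<in> gen_words S"
    by (simp add: gen_words_def)
  have one: "\<one>\<^bsub>?P\<^esub> = ?c []"
    by (simp add: presented_group_def)
  show "\<one>\<^bsub>?P\<^esub> \<in> carrier ?P"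
    using nil by (auto simp: one carrier_presented_group)
  show "A \<otimes>\<^bsub>?P\<^esub> B \<in> carrier ?P" if "A \<in> carrier ?P" "B \<in> carrier ?P" for A B
    using that by (auto simp: carrier_presented_group mult_presented_group app)
  show "A \<otimes>\<^bsub>?P\<^esub> B \<otimes>\<^bsub>?P\<^esub> C = A \<otimes>\<^bsub>?P\<^esub> (B \<otimes>\<^bsub>?P\<^esub> C)"
    if "A \<in> carrier ?P" "B \<in> carrier ?P" "C \<in> carrier ?P" for A B C
    using that by (auto simp: carrier_presented_group mult_presented_group app)
  show "\<one>\<^bsub>?P\<^esub> \<otimes>\<^bsub>?P\<^esub> A = A" if "A \<in> carrier ?P" for A
    using that nil by (auto simp: one carrier_presented_group mult_presented_group)
  show "\<exists>B\<in>carrier ?P. B \<otimes>\<^bsub>?P\<^esub> A = \<one>\<^bsub>?P\<^esub>" if "A \<in> carrier ?P" for A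
  proof -
    obtain w where w: "w \<in> gen_words S" "A = ?c w"
      using \<open>A \<in> carrier ?P\<close> by (auto simp: carrier_presented_group)
    let ?r = "rev (map (\<lambda>(x, b). (x, \<not> b)) w)"
    have r: "?r \<in> gen_words S"
      using w by (auto simp: gen_words_def)
    have "?c ?r \<otimes>\<^bsub>?P\<^esub> A = ?c (?r @ w)"
      using r w by (simp only: mult_presented_group)
    also have "\<dots> = ?c []"
      by (rule equiv_class_eq[OF equiv_word_cong inverse_word_cong[OF w(1)]])
    finally have "?c ?r \<otimes>\<^bsub>?P\<^esub> A = \<one>\<^bsub>?P\<^esub>"
      unfolding one .
    moreover have "?c ?r \<in> carrier ?P"
      unfolding carrier_presented_group using r by (rule imageI)
    ultimately show ?thesis ..
  qed
qed

lemma group_tensor_square: "group (tensor_square G)"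
  unfolding tensor_square_def by (rule group_presented_group)

lemma (in group) normal_normal_closure:
  assumes "S \<subseteq> carrier G" shows "normal_closure G S \<lhd> G"
proof -
  let ?F = "{N. N \<lhd> G \<and> S \<subseteq> N}"
  have sub: "subgroup (\<Inter>?F) G"
    using assms normal_self by (intro subgroups_Inter) (auto simp: normal_imp_subgroup)
  have "x \<otimes> h \<otimes> inv x \<in> \<Inter>?F" if "x \<in> carrier G" "h \<in> \<Inter>?F" for x h
    using that by (auto intro: normal.inv_op_closed2)
  with sub show ?thesis
    unfolding normal_closure_def by (intro normal_invI)
qed

lemma tensor_closed:
  assumes "g \<in> carrier G" "h \<in> carrier G"
  shows "tensor G g h \<in> carrier (tensor_square G)"
  unfolding tensor_def tensor_square_def carrier_presented_group
  using assms by (intro imageI) (simp add: gen_words_def)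

lemma normal_diagonal_closure: "diagonal_closure G \<lhd> tensor_square G"
proof -
  have "{tensor G g g | g. g \<in> carrier G} \<subseteq> carrier (tensor_square G)"
  proof
    fix t assume "t \<in> {tensor G g g | g. g \<in> carrier G}"
    then obtain g where "t = tensor G g g" "g \<in> carrier G" by blast
    then show "t \<in> carrier (tensor_square G)" by (simp only: tensor_closed)
  qed
  then show ?thesis
    unfolding diagonal_closure_def
    by (rule group.normal_normal_closure[OF group_tensor_square])
qed

lemma group_exterior_square: "group (exterior_square G)"
  unfolding exterior_square_def by (rule normal.factorgroup_is_group[OF normal_diagonal_closure])

lemma (in group) conj_by_closed:
  assumes "h \<in> carrier G" "g \<in> carrier G" shows "conj_by G h g \<in> carrier G"
  using assms by (simp add: conj_by_def)

lemma (in group) tensor_mult_left: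
  assumes "g \<in> carrier G" "h \<in> carrier G" "k \<in> carrier G"
  shows "tensor G (g \<otimes> k) h =
    tensor G (conj_by G g k) (conj_by G g h) \<otimes>\<^bsub>tensor_square G\<^esub> tensor G g h"
proof -
  let ?S = "carrier G \<times> carrier G"
  have w: "[((a, b), True)] \<in> gen_words ?S" if "a \<in> carrier G" "b \<in> carrier G" for a b
    using that by (auto simp: gen_words_def)
  have "([((g \<otimes> k, h), True)], [((conj_by G g k, conj_by G g h), True)] @ [((g, h), True)])
          \<in> word_cong ?S (tensor_rels G)"
    using assms conj_by_closed
    by (intro word_cong.rel) (auto simp: tensor_rels_def gen_words_def)
  from equiv_class_eq[OF equiv_word_cong this] show ?thesis
    using assms conj_by_closed unfolding tensor_def tensor_square_def
    by (subst mult_presented_group) (simp_all add: w)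
qed

lemma (in group) tensor_mult_right:
  assumes "g \<in> carrier G" "h \<in> carrier G" "k \<in> carrier G"
  shows "tensor G g (h \<otimes> k) =
    tensor G g h \<otimes>\<^bsub>tensor_square G\<^esub> tensor G (conj_by G h g) (conj_by G h k)"
proof -
  let ?S = "carrier G \<times> carrier G"
  have w: "[((a, b), True)] \<in> gen_words ?S" if "a \<in> carrier G" "b \<in> carrier G" for a b
    using that by (auto simp: gen_words_def)
  have "([((g, h \<otimes> k), True)], [((g, h), True)] @ [((conj_by G h g, conj_by G h k), True)])
          \<in> word_cong ?S (tensor_rels G)"
    using assms conj_by_closed
    by (intro word_cong.rel) (auto simp: tensor_rels_def gen_words_def)
  from equiv_class_eq[OF equiv_word_cong this] show ?thesis
    using assms conj_by_closed unfolding tensor_def tensor_square_def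
    by (subst mult_presented_group) (simp_all add: w)
qed

lemma wedge_self:
  assumes "g \<in> carrier G" shows "wedge G g g = \<one>\<^bsub>exterior_square G\<^esub>"
proof -
  have "tensor G g g \<in> diagonal_closure G"
    using assms by (auto simp: diagonal_closure_def normal_closure_def)
  then show ?thesis
    unfolding wedge_def exterior_square_def one_FactGroup
    by (intro subgroup.rcos_const normal_imp_subgroup normal_diagonal_closure group_tensor_square)
qed

end

theory Submission
  imports Defs "HOL-Algebra.Multiplicative_Group" "HOL-Number_Theory.Cong"
begin

text \<open>
  The relation \<open>x \<and> y = 1\<close> behaves like commutation. It is reflexive and symmetric, the exterior
  centralizer \<open>C(x)\<close> is a subgroup, and the exterior center \<open>Z\<close> is normal. Reflexivity is a defining
  relation; the rest rests on the universal property of the exterior square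
  (\<open>exterior_pairing_vanishes\<close>): a map on pairs that satisfies the defining relations is trivial at
  \<open>(x, y)\<close> whenever \<open>x \<and> y = 1\<close>. Conjugates of wedges, inverses of swapped wedges and
  commutators are all such maps.

  The hypothesis that \<open>G\<close> is not cyclic enters through \<open>cyclic_if_wedge_trivial\<close>, by which
  \<open>Z \<noteq> G\<close>. A finite abelian group \<open>G\<close> of exponent \<open>m\<close> has an element \<open>x\<close> of order \<open>m\<close> and a character \<open>\<chi>\<close> to \<open>\<int>/m\<close> with \<open>\<chi>(x) = 1\<close>; the
  alternating form \<open>g^\<chi>(h) h^-\<chi>(g)\<close> vanishes identically only if every \<open>g\<close> is a power of \<open>x\<close>.

  The rest is a count. Let \<open>d_k\<close> be the density of the tuples of length \<open>k\<close> with pairwise trivial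
  wedges, and \<open>z = |Z| / |G|\<close>. Fixing the last entry \<open>y\<close> confines the others to \<open>C(y)\<close>, which is \<open>G\<close> for
  \<open>y \<in> Z\<close> and otherwise has index at least \<open>p\<close>. Hence
  \<open>d_(k+1) \<le> z d_k + (1 - z) p^-k\<close>. For \<open>y\<close> outside \<open>Z\<close> the chain \<open>Z < C(y) < G\<close> is strict, so
  \<open>z \<le> 1/p^2\<close>, and inserting this value for \<open>z\<close> gives the recursion of the claimed bound. For
  \<open>k \<ge> 1\<close> the bound for \<open>d_k\<close> exceeds \<open>p^-k\<close>, so a smaller \<open>z\<close> gives a strict inequality; for
  \<open>z = 1/p^2\<close> each \<open>C(y)\<close> with \<open>y\<close> outside \<open>Z\<close> has index \<open>p\<close> and pairwise trivial wedges, and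
  equality holds throughout. So equality means that \<open>G/Z\<close> has order \<open>p^2\<close>. As \<open>Z \<noteq> G\<close>, the quotient
  \<open>G/Z\<close> is never cyclic, and a non-cyclic group of order \<open>p^2\<close> is elementary abelian.
\<close>

section \<open>Pairings and the universal property of the exterior square\<close>

text \<open>
  These are the maps that factor through the exterior square: the first two identities are the
  defining relations of the tensor square, the last one is the extra relation of the exterior
  square.
\<close>

definition exterior_pairing ::
    "('a, 'b) monoid_scheme \<Rightarrow> ('c, 'd) monoid_scheme \<Rightarrow> ('a \<Rightarrow> 'a \<Rightarrow> 'c) \<Rightarrow> bool"
  where "exterior_pairing G H f \<longleftrightarrow>
    (\<forall>g\<in>carrier G. \<forall>h\<in>carrier G. f g h \<in> carrier H) \<and>
    (\<forall>g\<in>carrier G. \<forall>k\<in>carrier G. \<forall>h\<in>carrier G.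
       f (g \<otimes>\<^bsub>G\<^esub> k) h = f (conj_by G g k) (conj_by G g h) \<otimes>\<^bsub>H\<^esub> f g h) \<and>
    (\<forall>g\<in>carrier G. \<forall>h\<in>carrier G. \<forall>k\<in>carrier G.
       f g (h \<otimes>\<^bsub>G\<^esub> k) = f g h \<otimes>\<^bsub>H\<^esub> f (conj_by G h g) (conj_by G h k)) \<and>
    (\<forall>g\<in>carrier G. f g g = \<one>\<^bsub>H\<^esub>)"

fun word_value :: "('c, 'd) monoid_scheme \<Rightarrow> ('x \<Rightarrow> 'c) \<Rightarrow> 'x gen_word \<Rightarrow> 'c" where
  "word_value H v [] = \<one>\<^bsub>H\<^esub>"
| "word_value H v ((x, b) # w) = (if b then v x else inv\<^bsub>H\<^esub> v x) \<otimes>\<^bsub>H\<^esub> word_value H v w"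

context
  fixes H :: "('c, 'd) monoid_scheme" (structure) and S :: "'x set"
    and R :: "('x gen_word \<times> 'x gen_word) set" and v :: "'x \<Rightarrow> 'c"
  assumes H: "group H" and v: "\<And>x. x \<in> S \<Longrightarrow> v x \<in> carrier H"
begin

interpretation H: group H by (rule H)

lemma word_value_closed: "w \<in> gen_words S \<Longrightarrow> word_value H v w \<in> carrier H"
  by (induction w) (auto simp: gen_words_def v)

lemma word_value_append:
  assumes "u \<in> gen_words S" "w \<in> gen_words S"
  shows "word_value H v (u @ w) = word_value H v u \<otimes> word_value H v w"
  using assms
proof (induction u)
  case Nil
  then show ?case by (simp add: word_value_closed)
next
  case (Cons l u)
  obtain x b where l: "l = (x, b)" by (cases l)
  have u: "x \<in> S" "u \<in> gen_words S" using Cons.prems by (auto simp: l gen_words_def)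
  then show ?case
    using Cons.IH Cons.prems
    by (auto simp: l H.m_assoc word_value_closed v)
qed

lemma word_value_cong:
  assumes R: "\<And>u w. (u, w) \<in> R \<Longrightarrow> word_value H v u = word_value H v w"
    and "(u, w) \<in> word_cong S R"
  shows "word_value H v u = word_value H v w"
  using assms(2)
proof induction
  case (append u u' w w')
  then show ?case
    using word_cong_words by (metis word_value_append)
qed (use R in \<open>auto simp: v\<close>)

text \<open>
  Von Dyck's theorem: an assignment of the generators that respects the relations extends to the
  presented group. The homomorphism evaluates any word representing the given class.
\<close>

lemma presented_group_hom:
  assumes R: "\<And>u w. (u, w) \<in> R \<Longrightarrow> word_value H v u = word_value H v w"
  obtains \<phi> where "group_hom (presented_group S R) H \<phi>"
    and "\<And>w. w \<in> gen_words S \<Longrightarrow> \<phi> (word_cong S R `` {w}) = word_value H v w"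
proof
  let ?\<phi> = "\<lambda>A. the_elem (word_value H v ` A)"
  show val: "?\<phi> (word_cong S R `` {w}) = word_value H v w" if "w \<in> gen_words S" for w
  proof -
    have "word_value H v ` (word_cong S R `` {w}) = {word_value H v w}"
      using word_value_cong[OF R] word_cong.refl[OF that] by (auto intro: rev_image_eqI)
    then show ?thesis by simp
  qed
  have app: "u @ w \<in> gen_words S" if "u \<in> gen_words S" "w \<in> gen_words S" for u w
    using that by (auto simp: gen_words_def)
  show "group_hom (presented_group S R) H ?\<phi>"
    by (rule group_hom.intro[OF group_presented_group H], unfold_locales)
      (auto simp: hom_def carrier_presented_group mult_presented_group app val
        word_value_closed word_value_append)
qed

end

lemma wedge_eq_one_iff:
  assumes "x \<in> carrier G" "y \<in> carrier G"
  shows "wedge G x y = \<one>\<^bsub>exterior_square G\<^esub> \<longleftrightarrow> tensor G x y \<in> diagonal_closure G"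
proof -
  interpret T: group "tensor_square G" by (rule group_tensor_square)
  interpret N: normal "diagonal_closure G" "tensor_square G" by (rule normal_diagonal_closure)
  show ?thesis
    unfolding wedge_def exterior_square_def one_FactGroup
    using tensor_closed[OF assms] N.rcos_const T.rcos_self N.subgroup_axioms T.is_group by metis
qed

text \<open>
  Everything below that needs \<open>x \<and> y\<close> to have a consequence goes through this fact: to see
  what \<open>x \<and> y = 1\<close> implies, choose a pairing. The pairing induces a homomorphism on the tensor square
  whose kernel is normal and contains the diagonal, so it contains the normal closure of the
  diagonal and hence every tensor that becomes trivial in the exterior square.
\<close>

proposition exterior_pairing_vanishes:
  assumes "group G" "group H" and f: "exterior_pairing G H f"
    and xy: "x \<in> carrier G" "y \<in> carrier G" "wedge G x y = \<one>\<^bsub>exterior_square G\<^esub>"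
  shows "f x y = \<one>\<^bsub>H\<^esub>"
proof -
  interpret G: group G by fact
  interpret H: group H by fact
  let ?S = "carrier G \<times> carrier G" and ?R = "tensor_rels G" and ?v = "\<lambda>(g, h). f g h"
  have v: "?v s \<in> carrier H" if "s \<in> ?S" for s
    using that f by (auto simp: exterior_pairing_def)
  have "word_value H ?v u = word_value H ?v w" if "(u, w) \<in> ?R" for u w
    using that f by (auto simp: tensor_rels_def exterior_pairing_def G.conj_by_closed)
  from presented_group_hom[OF \<open>group H\<close> v this]
  obtain \<phi> where hom: "group_hom (tensor_square G) H \<phi>"
    and \<phi>: "\<And>w. w \<in> gen_words ?S \<Longrightarrow> \<phi> (word_cong ?S ?R `` {w}) = word_value H ?v w"
    unfolding tensor_square_def by blast
  interpret \<phi>: group_hom "tensor_square G" H \<phi> by (rule hom)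
  have val: "\<phi> (tensor G g h) = f g h" if "g \<in> carrier G" "h \<in> carrier G" for g h
    unfolding tensor_def using that v[of "(g, h)"] by (subst \<phi>) (auto simp: gen_words_def)
  have "{tensor G g g | g. g \<in> carrier G} \<subseteq> kernel (tensor_square G) H \<phi>"
    using f by (auto simp: kernel_def val tensor_closed exterior_pairing_def)
  then have "diagonal_closure G \<subseteq> kernel (tensor_square G) H \<phi>"
    unfolding diagonal_closure_def normal_closure_def
    by (intro Inter_lower CollectI conjI \<phi>.normal_kernel)
  moreover have "tensor G x y \<in> diagonal_closure G"
    using xy by (simp add: wedge_eq_one_iff)
  ultimately have "\<phi> (tensor G x y) = \<one>\<^bsub>H\<^esub>"
    unfolding kernel_def by (simp add: subset_iff)
  then show ?thesis using val xy by simp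
qed

section \<open>Exterior centralizers and the exterior center\<close>

context group
begin

lemma conj_by_mult:
  assumes "a \<in> carrier G" "x \<in> carrier G" "y \<in> carrier G"
  shows "conj_by G a (x \<otimes> y) = conj_by G a x \<otimes> conj_by G a y"
  using assms by (simp add: conj_by_def m_assoc inv_solve_left)

lemma conj_by_commuting:
  assumes "a \<in> carrier G" "x \<in> carrier G" "x \<otimes> a = a \<otimes> x"
  shows "conj_by G a x = x"
  using assms by (metis conj_by_def inv_solve_right' m_closed)

lemma conj_by_conj_by:
  assumes "a \<in> carrier G" "b \<in> carrier G" "x \<in> carrier G"
  shows "conj_by G a (conj_by G b x) = conj_by G (conj_by G a b) (conj_by G a x)"
proof -
  have "a \<otimes> (b \<otimes> (x \<otimes> (inv b \<otimes> inv a))) =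
      a \<otimes> (b \<otimes> (inv a \<otimes> (a \<otimes> (x \<otimes> (inv a \<otimes> (a \<otimes> (inv b \<otimes> inv a)))))))"
    using assms by (simp flip: m_assoc)
  then show ?thesis
    using assms by (simp add: conj_by_def m_assoc inv_mult_group)
qed

lemma exterior_pairing_wedge: "exterior_pairing G (exterior_square G) (wedge G)"
proof -
  interpret T: group "tensor_square G" by (rule group_tensor_square)
  interpret N: normal "diagonal_closure G" "tensor_square G" by (rule normal_diagonal_closure)
  let ?q = "\<lambda>a. diagonal_closure G #>\<^bsub>tensor_square G\<^esub> a"
  have hom: "?q \<in> hom (tensor_square G) (exterior_square G)"
    unfolding exterior_square_def by (rule N.r_coset_hom_Mod)
  have self: "?q (tensor G g g) = \<one>\<^bsub>exterior_square G\<^esub>" if "g \<in> carrier G" for g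
    using wedge_self[OF that] by (simp add: wedge_def)
  show ?thesis
    unfolding exterior_pairing_def
    using self hom_in_carrier[OF hom] hom_mult[OF hom]
    by (simp add: wedge_def tensor_closed tensor_mult_left tensor_mult_right conj_by_closed)
qed

text \<open>
  Conjugation acts on the exterior square: \<open>(x, y) \<mapsto> a x a\<inverse> \<and> a y a\<inverse>\<close> is again a pairing.
\<close>

lemma wedge_conj_by:
  assumes "x \<in> carrier G" "y \<in> carrier G" "a \<in> carrier G"
    and "wedge G x y = \<one>\<^bsub>exterior_square G\<^esub>"
  shows "wedge G (conj_by G a x) (conj_by G a y) = \<one>\<^bsub>exterior_square G\<^esub>"
proof (rule exterior_pairing_vanishes[OF is_group group_exterior_square _ assms(1,2,4)])
  show "exterior_pairing G (exterior_square G) (\<lambda>x y. wedge G (conj_by G a x) (conj_by G a y))"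
    using exterior_pairing_wedge assms(3)
    by (simp add: exterior_pairing_def conj_by_closed conj_by_mult flip: conj_by_conj_by)
qed

text \<open>
  The two defining relations of the tensor square are exchanged by swapping the arguments and
  inverting, so \<open>(x, y) \<mapsto> (y \<and> x)\<inverse>\<close> is a pairing too.
\<close>

lemma wedge_sym:
  assumes "x \<in> carrier G" "y \<in> carrier G" "wedge G x y = \<one>\<^bsub>exterior_square G\<^esub>"
  shows "wedge G y x = \<one>\<^bsub>exterior_square G\<^esub>"
proof -
  let ?E = "exterior_square G"
  interpret E: group ?E by (rule group_exterior_square)
  have "exterior_pairing G ?E (\<lambda>x y. inv\<^bsub>?E\<^esub> wedge G y x)"
    using exterior_pairing_wedge
    by (simp add: exterior_pairing_def conj_by_closed E.inv_mult_group)
  from exterior_pairing_vanishes[OF is_group group_exterior_square this assms]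
  show ?thesis
    using assms exterior_pairing_wedge by (auto simp: exterior_pairing_def)
qed

text \<open>
  The commutator is a pairing of the group with itself.
\<close>

lemma wedge_imp_commute:
  assumes "x \<in> carrier G" "y \<in> carrier G" "wedge G x y = \<one>\<^bsub>exterior_square G\<^esub>"
  shows "x \<otimes> y = y \<otimes> x"
proof -
  have cancel: "inv a \<otimes> (a \<otimes> b) = b" if "a \<in> carrier G" "b \<in> carrier G" for a b
    using that by (simp flip: m_assoc)
  have "exterior_pairing G G (\<lambda>x y. x \<otimes> y \<otimes> inv x \<otimes> inv y)"
    by (simp add: exterior_pairing_def conj_by_def inv_mult_group m_assoc cancel)
  from exterior_pairing_vanishes[OF is_group is_group this assms]
  show ?thesis
    using assms by (metis inv_closed inv_equality inv_inv inv_mult_group m_assoc m_closed)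
qed

text \<open>
  The map \<open>y \<mapsto> x \<and> y\<close> is not a homomorphism, but a crossed one, twisted by conjugation with
  \<open>y\<close>. If \<open>x \<and> y = 1\<close> then conjugation by \<open>y\<close> fixes \<open>x\<close>, and the twist only replaces
  \<open>x \<and> z\<close> by its conjugate, which is trivial exactly when \<open>x \<and> z\<close> is.
\<close>

lemma subgroup_exterior_centralizer:
  assumes x: "x \<in> carrier G" shows "subgroup (exterior_centralizer G x) G"
proof -
  let ?E = "exterior_square G"
  interpret E: group ?E by (rule group_exterior_square)
  have P: "wedge G x (y \<otimes> z) = wedge G x y \<otimes>\<^bsub>?E\<^esub> wedge G (conj_by G y x) (conj_by G y z)"
    if "y \<in> carrier G" "z \<in> carrier G" for y z
    using exterior_pairing_wedge that x by (auto simp: exterior_pairing_def)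
  have cl: "wedge G y z \<in> carrier ?E" if "y \<in> carrier G" "z \<in> carrier G" for y z
    using exterior_pairing_wedge that by (auto simp: exterior_pairing_def)
  have fixed: "conj_by G y x = x" if "y \<in> carrier G" "wedge G x y = \<one>\<^bsub>?E\<^esub>" for y
    using wedge_imp_commute[OF x that] that x by (simp add: conj_by_commuting)
  have split: "wedge G x (y \<otimes> z) = wedge G x (conj_by G y z)"
    if "y \<in> carrier G" "wedge G x y = \<one>\<^bsub>?E\<^esub>" "z \<in> carrier G" for y z
    using P[OF that(1,3)] fixed[OF that(1,2)] that x by (simp add: cl conj_by_closed)
  have one: "wedge G x \<one> = \<one>\<^bsub>?E\<^esub>"
    using P[of \<one> \<one>] x cl[of x \<one>] by (simp add: conj_by_def)
  show ?thesis
  proof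
    show "exterior_centralizer G x \<subseteq> carrier G" by (auto simp: exterior_centralizer_def)
    show "\<one> \<in> exterior_centralizer G x" using one by (simp add: exterior_centralizer_def)
  next
    fix y z assume "y \<in> exterior_centralizer G x" "z \<in> exterior_centralizer G x"
    then have y: "y \<in> carrier G" "wedge G x y = \<one>\<^bsub>?E\<^esub>"
      and z: "z \<in> carrier G" "wedge G x z = \<one>\<^bsub>?E\<^esub>" by (auto simp: exterior_centralizer_def)
    show "y \<otimes> z \<in> exterior_centralizer G x"
      using split[OF y z(1)] fixed[OF y] wedge_conj_by[OF x z(1) y(1) z(2)] y z
      by (simp add: exterior_centralizer_def)
  next
    fix y assume "y \<in> exterior_centralizer G x"
    then have y: "y \<in> carrier G" "wedge G x y = \<one>\<^bsub>?E\<^esub>" by (auto simp: exterior_centralizer_def)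
    have "conj_by G y (inv y) = inv y" using y by (simp add: conj_by_def)
    then show "inv y \<in> exterior_centralizer G x"
      using split[OF y, of "inv y"] y one by (simp add: exterior_centralizer_def)
  qed
qed

lemma exterior_center_subset: "exterior_center G \<subseteq> carrier G"
  using one_closed by (auto simp: exterior_center_def exterior_centralizer_def)

lemma normal_exterior_center: "exterior_center G \<lhd> G"
proof (rule normal_invI)
  show "subgroup (exterior_center G) G"
    unfolding exterior_center_def using subgroup_exterior_centralizer
    by (intro subgroups_Inter) auto
next
  fix a z assume a: "a \<in> carrier G" and z: "z \<in> exterior_center G"
  have zG: "z \<in> carrier G" using z exterior_center_subset by auto
  have "wedge G x (conj_by G a z) = \<one>\<^bsub>exterior_square G\<^esub>" if x: "x \<in> carrier G" for x
  proof -
    have "conj_by G a (conj_by G (inv a) x) = x"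
      using a x by (simp add: conj_by_def m_assoc) (simp flip: m_assoc)
    moreover have "wedge G (conj_by G (inv a) x) z = \<one>\<^bsub>exterior_square G\<^esub>"
      using z a x by (auto simp: exterior_center_def exterior_centralizer_def conj_by_closed)
    ultimately show ?thesis
      using wedge_conj_by[of "conj_by G (inv a) x" z a] a x zG by (simp add: conj_by_closed)
  qed
  then show "a \<otimes> z \<otimes> inv a \<in> exterior_center G"
    using a zG conj_by_closed[OF a zG]
    by (auto simp: exterior_center_def exterior_centralizer_def conj_by_def)
qed

end

section \<open>Extension of characters of finite abelian groups\<close>

lemma (in group) subgroup_pow_closed:
  assumes "subgroup H G" "a \<in> H" shows "a [^] (t::nat) \<in> H"
  using assms by (induction t) (auto intro: subgroup.m_closed subgroup.one_closed)

lemma (in comm_group) ord_mult_dvd_ord_mult: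
  assumes x: "x \<in> carrier G" and y: "y \<in> carrier G" and "coprime (ord x) (ord y)"
  shows "ord x * ord y dvd ord (x \<otimes> y)"
proof -
  have *: "ord u dvd ord (u \<otimes> v)"
    if u: "u \<in> carrier G" and v: "v \<in> carrier G" and "coprime (ord u) (ord v)" for u v
  proof -
    let ?k = "ord (u \<otimes> v) * ord v"
    have "u [^] ?k \<otimes> v [^] ?k = (u \<otimes> v) [^] ?k"
      using u v by (simp add: pow_mult_distrib m_comm)
    also have "\<dots> = \<one>" using u v by (subst pow_eq_id) auto
    finally have "u [^] ?k \<otimes> v [^] ?k = \<one>" .
    moreover have "v [^] ?k = \<one>" using v by (subst pow_eq_id) auto
    ultimately have "u [^] ?k = \<one>" using u by simp
    then have "ord u dvd ?k" using u pow_eq_id by blast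
    then show ?thesis using that(3) by (simp add: coprime_dvd_mult_left_iff)
  qed
  show ?thesis
    using *[OF x y assms(3)] *[OF y x] assms by (simp add: divides_mult m_comm coprime_commute)
qed

text \<open>
  An element of maximal order works. If the order of some \<open>g\<close> does not divide it, a prime \<open>q\<close> occurs
  more often in the order of \<open>g\<close> than in that of \<open>x\<close>; combining the \<open>q\<close>-part of \<open>g\<close> with the part
  of \<open>x\<close> prime to \<open>q\<close> gives an element of larger order.
\<close>

lemma (in comm_group) obtain_ord_exponent:
  assumes fin: "finite (carrier G)"
  obtains x where "x \<in> carrier G" "\<And>g. g \<in> carrier G \<Longrightarrow> g [^] ord x = \<one>"
proof -
  have pos: "ord g > 0" if "g \<in> carrier G" for g
    using ord_ge_1[OF fin that] by simp
  obtain x where x: "x \<in> carrier G" and max: "\<And>g. g \<in> carrier G \<Longrightarrow> ord g \<le> ord x"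
  proof -
    have "Max (ord ` carrier G) \<in> ord ` carrier G"
      using fin one_closed by (intro Max_in) auto
    then obtain x where "x \<in> carrier G" "ord x = Max (ord ` carrier G)" by fastforce
    then show ?thesis using that[of x] fin by simp
  qed
  have "ord g dvd ord x" if g: "g \<in> carrier G" for g
  proof (rule ccontr)
    let ?m = "ord x" and ?n = "ord g"
    assume "\<not> ?n dvd ?m"
    then obtain q where q: "prime q" and less: "multiplicity q ?m < multiplicity q ?n"
      using multiplicity_le_imp_dvd[of ?n ?m] pos[OF g] by (metis less_irrefl not_le)
    let ?a = "multiplicity q ?m" and ?b = "multiplicity q ?n"
    obtain m' where m': "?m = q ^ ?a * m'" "\<not> q dvd m'"
      by (rule multiplicity_decompose'[of ?m q]) (use pos[OF x] q not_prime_unit in auto)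
    obtain n' where n': "?n = q ^ ?b * n'"
      using multiplicity_dvd[of q ?n] by (elim dvdE)
    have q0: "q > 0" using q by (rule prime_gt_0_nat)
    have "n' > 0" using n' pos[OF g] by (cases n') auto
    let ?u = "x [^] q ^ ?a" and ?v = "g [^] n'"
    have u: "ord ?u = m'"
      using ord_pow[OF x, of "q ^ ?a"] m' q0 by (metis dvd_triv_left nonzero_mult_div_cancel_left power_eq_0_iff less_irrefl)
    have v: "ord ?v = q ^ ?b"
      using ord_pow[OF g, of n'] n' \<open>n' > 0\<close> by (metis dvd_triv_right nonzero_mult_div_cancel_right less_irrefl)
    have "coprime (ord ?u) (ord ?v)"
      using prime_imp_coprime[OF q m'(2)] by (simp add: u v coprime_commute)
    then have "m' * q ^ ?b dvd ord (?u \<otimes> ?v)"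
      using ord_mult_dvd_ord_mult[of ?u ?v] x g by (simp add: u v)
    then have "m' * q ^ ?b \<le> ord (?u \<otimes> ?v)"
      using pos x g by (intro dvd_imp_le) auto
    also have "\<dots> \<le> q ^ ?a * m'"
      using max[of "?u \<otimes> ?v"] x g m'(1) by simp
    finally have "m' * q ^ ?b \<le> m' * q ^ ?a" by (simp only: mult.commute)
    moreover have "m' > 0" using m'(2) by (intro gr0I) auto
    ultimately have "q ^ ?b \<le> q ^ ?a" by simp
    then show False
      using power_strict_increasing[OF less prime_gt_1_nat[OF q]] by simp
  qed
  then show ?thesis
    using that[OF x] by (simp add: pow_eq_id)
qed

context comm_group
begin

text \<open>
  A character of \<open>H\<close> with values in \<open>\<int>/m\<close>, given by integer representatives of its values so that
  these can serve directly as exponents.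
\<close>

definition character_mod :: "nat \<Rightarrow> 'a set \<Rightarrow> ('a \<Rightarrow> int) \<Rightarrow> bool"
  where "character_mod m H \<chi> \<longleftrightarrow> (\<forall>a\<in>H. \<forall>b\<in>H. [\<chi> (a \<otimes> b) = \<chi> a + \<chi> b] (mod int m))"

lemma character_mod_pow:
  assumes "subgroup H G" "character_mod m H \<chi>" "a \<in> H"
  shows "[\<chi> (a [^] (t::nat)) = int t * \<chi> a] (mod int m)"
proof (induction t)
  case 0
  have "[\<chi> (\<one> \<otimes> \<one>) = \<chi> \<one> + \<chi> \<one>] (mod int m)"
    using assms subgroup.one_closed by (fastforce simp: character_mod_def)
  then show ?case by (simp add: cong_iff_dvd_diff)
next
  case (Suc t)
  have "a [^] t \<in> H" using assms by (simp add: subgroup_pow_closed)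
  then have "[\<chi> (a [^] Suc t) = \<chi> (a [^] t) + \<chi> a] (mod int m)"
    using assms by (simp add: character_mod_def)
  also have "[\<chi> (a [^] t) + \<chi> a = int t * \<chi> a + \<chi> a] (mod int m)"
    using Suc by (intro cong_add) auto
  finally show ?case by (simp add: algebra_simps)
qed

text \<open>
  The value \<open>s\<close> at \<open>g\<close> may be prescribed as soon as it agrees with \<open>\<chi>\<close> on the powers of \<open>g\<close> that
  lie in \<open>H\<close>. Then \<open>h g^i \<mapsto> \<chi> h + i s\<close> does not depend on the chosen representation.
\<close>

lemma extend_character_by:
  assumes fin: "finite (carrier G)" and H: "subgroup H G" and \<chi>: "character_mod m H \<chi>"
    and g: "g \<in> carrier G"
    and s: "\<And>t::nat. g [^] t \<in> H \<Longrightarrow> [\<chi> (g [^] t) = int t * s] (mod int m)"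
  shows "\<exists>K \<psi>. subgroup K G \<and> H \<subseteq> K \<and> g \<in> K \<and> character_mod m K \<psi> \<and>
    (\<forall>h\<in>H. [\<psi> h = \<chi> h] (mod int m)) \<and> [\<psi> g = s] (mod int m)"
proof -
  interpret H: subgroup H G by (rule H)
  \<comment> \<open>a chosen representation \<open>y = h g^i\<close>, as a pair \<open>(h, i)\<close>\<close>
  define c where "c y = (SOME hi. fst hi \<in> H \<and> y = fst hi \<otimes> g [^] (snd hi :: nat))" for y
  define \<psi> where "\<psi> y = \<chi> (fst (c y)) + int (snd (c y)) * s" for y
  have le: "[\<chi> h + int i * s = \<chi> h' + int j * s] (mod int m)"
    if "h \<in> H" "h' \<in> H" "h \<otimes> g [^] i = h' \<otimes> g [^] j" "i \<le> j" for h h' i j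
  proof -
    have "h \<otimes> g [^] i = (h' \<otimes> g [^] (j - i)) \<otimes> g [^] i"
      using that g by (simp add: m_assoc nat_pow_mult H.mem_carrier)
    then have h: "h = h' \<otimes> g [^] (j - i)"
      using that g by (simp add: H.mem_carrier)
    then have "g [^] (j - i) = inv h' \<otimes> h"
      using that g by (simp add: H.mem_carrier inv_solve_left)
    then have gH: "g [^] (j - i) \<in> H" using that by simp
    have "[\<chi> h = \<chi> h' + \<chi> (g [^] (j - i))] (mod int m)"
      using \<chi> gH that h by (simp add: character_mod_def)
    also have "[\<chi> h' + \<chi> (g [^] (j - i)) = \<chi> h' + int (j - i) * s] (mod int m)"
      using s[OF gH] by (intro cong_add) auto
    finally have "[\<chi> h + int i * s = \<chi> h' + int (j - i) * s + int i * s] (mod int m)"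
      by (intro cong_add) auto
    then show ?thesis using \<open>i \<le> j\<close> by (simp add: of_nat_diff algebra_simps)
  qed
  have \<psi>: "[\<psi> (h \<otimes> g [^] i) = \<chi> h + int i * s] (mod int m)" if "h \<in> H" for h and i :: nat
  proof -
    let ?h = "fst (c (h \<otimes> g [^] i))" and ?j = "snd (c (h \<otimes> g [^] i))"
    have "?h \<in> H \<and> h \<otimes> g [^] i = ?h \<otimes> g [^] ?j"
      unfolding c_def by (rule someI[of _ "(h, i)"]) (use that in simp)
    then have "[\<chi> h + int i * s = \<chi> ?h + int ?j * s] (mod int m)"
      using le[of h ?h i ?j] le[of ?h h ?j i] that cong_sym nat_le_linear by metis
    then show ?thesis unfolding \<psi>_def by (rule cong_sym)
  qed
  let ?K = "H <#> generate G {g}"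
  have gen: "generate G {g} = range (\<lambda>i::nat. g [^] i)"
    using generate_pow_on_finite_carrier[OF fin g] by auto
  have K: "y \<in> ?K \<longleftrightarrow> (\<exists>h\<in>H. \<exists>i::nat. y = h \<otimes> g [^] i)" for y
    by (auto simp: set_mult_def gen)
  show ?thesis
  proof (intro exI conjI ballI)
    show "subgroup ?K G"
      using H g by (intro mult_subgroups generate_is_subgroup) auto
    show "H \<subseteq> ?K" using K H.mem_carrier by (metis nat_pow_0 r_one subsetI)
    show "g \<in> ?K" using K g H.one_closed by (metis l_one nat_pow_eone)
    show "[\<psi> h = \<chi> h] (mod int m)" if "h \<in> H" for h
      using \<psi>[OF that, of 0] that by (simp add: H.mem_carrier)
    have "[\<chi> \<one> = 0] (mod int m)"
      using character_mod_pow[OF H \<chi> H.one_closed, of 0] by simp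
    then have "[\<chi> \<one> + s = 0 + s] (mod int m)" by (intro cong_add) auto
    then show "[\<psi> g = s] (mod int m)"
      using \<psi>[OF H.one_closed, of 1] g cong_trans by fastforce
    show "character_mod m ?K \<psi>"
      unfolding character_mod_def
    proof (intro ballI)
      fix a b assume "a \<in> ?K" "b \<in> ?K"
      then obtain h h' and i j :: nat where a: "h \<in> H" "a = h \<otimes> g [^] i" and b: "h' \<in> H" "b = h' \<otimes> g [^] j"
        by (auto simp: K)
      have "a \<otimes> b = (h \<otimes> h') \<otimes> g [^] (i + j)"
        using a b g by (simp add: H.mem_carrier m_ac flip: nat_pow_mult)
      then have "[\<psi> (a \<otimes> b) = \<chi> (h \<otimes> h') + int (i + j) * s] (mod int m)"
        using \<psi>[of "h \<otimes> h'" "i + j"] a b by simp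
      also have "[\<chi> (h \<otimes> h') + int (i + j) * s = \<chi> h + \<chi> h' + int (i + j) * s] (mod int m)"
        using \<chi> a b by (intro cong_add) (auto simp: character_mod_def)
      also have "\<chi> h + \<chi> h' + int (i + j) * s = (\<chi> h + int i * s) + (\<chi> h' + int j * s)"
        by (simp add: algebra_simps)
      also have "[(\<chi> h + int i * s) + (\<chi> h' + int j * s) = \<psi> a + \<psi> b] (mod int m)"
        using a b \<psi> by (intro cong_add cong_sym[OF \<psi>]) (auto intro: cong_sym)
      finally show "[\<psi> (a \<otimes> b) = \<psi> a + \<psi> b] (mod int m)" .
    qed
  qed
qed

text \<open>
  The group \<open>\<int>/m\<close> is injective among the abelian groups of exponent dividing \<open>m\<close>. If \<open>k\<close> is the order of \<open>g\<close>
  modulo \<open>H\<close> and \<open>m = k d\<close>, then \<open>d \<chi> (g^k)\<close> represents the value at \<open>g^m = 1\<close>, so it is divisible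
  by \<open>k d\<close>; hence \<open>\<chi> (g^k)\<close> is divisible by \<open>k\<close>, and the quotient is a possible value at \<open>g\<close>.
\<close>

lemma extend_character:
  assumes fin: "finite (carrier G)" and m: "m > 0" "\<And>g. g \<in> carrier G \<Longrightarrow> g [^] m = \<one>"
    and "subgroup H G" "character_mod m H \<chi>"
  shows "\<exists>\<psi>. character_mod m (carrier G) \<psi> \<and> (\<forall>h\<in>H. [\<psi> h = \<chi> h] (mod int m))"
  using assms(4,5)
proof (induction "card (carrier G) - card H" arbitrary: H \<chi> rule: less_induct)
  case less
  interpret H: subgroup H G by (rule less.prems(1))
  show ?case
  proof (cases "H = carrier G")
    case True
    then show ?thesis using less.prems by auto
  next
    case False
    then obtain g where g: "g \<in> carrier G" "g \<notin> H" using H.subset by auto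
    define k where "k = (LEAST k. k > 0 \<and> g [^] (k::nat) \<in> H)"
    have k: "k > 0" "g [^] k \<in> H"
      using LeastI[of "\<lambda>k. k > 0 \<and> g [^] (k::nat) \<in> H" m] m g by (auto simp: k_def)
    have dvd: "k dvd t" if "g [^] t \<in> H" for t :: nat
    proof (rule ccontr)
      assume "\<not> k dvd t"
      then have "t mod k > 0" by (simp add: mod_greater_zero_iff_not_dvd)
      have "g [^] t = g [^] (k * (t div k)) \<otimes> g [^] (t mod k)"
        using g by (simp add: nat_pow_mult)
      then have "g [^] (t mod k) = inv (g [^] (k * (t div k))) \<otimes> g [^] t"
        using g by (simp add: inv_solve_left)
      moreover have "g [^] (k * (t div k)) \<in> H"
        using k g subgroup_pow_closed[OF less.prems(1) k(2), of "t div k"] by (simp add: nat_pow_pow)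
      ultimately have "g [^] (t mod k) \<in> H" using that by simp
      then have "k \<le> t mod k"
        unfolding k_def using \<open>t mod k > 0\<close> k_def by (intro Least_le) auto
      then show False using mod_less_divisor[OF k(1), of t] by simp
    qed
    have "k dvd m" using dvd[of m] m g by simp
    then obtain d where d: "m = k * d" by auto
    have gkt: "[\<chi> (g [^] (k * t)) = int t * \<chi> (g [^] k)] (mod int m)" for t
      using character_mod_pow[OF less.prems(1,2) k(2), of t] g by (simp add: nat_pow_pow)
    have "[0 = int d * \<chi> (g [^] k)] (mod int m)"
      using gkt[of d] character_mod_pow[OF less.prems(1,2) H.one_closed, of 0] m(2)[OF g(1)] d cong_sym cong_trans
      by (metis mult_zero_left nat_pow_0 of_nat_0)
    then have "int k * int d dvd int d * \<chi> (g [^] k)"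
      by (metis cong_0_iff cong_sym d of_nat_mult)
    then have "int k dvd \<chi> (g [^] k)" using m(1) d by (simp add: mult.commute)
    then obtain s where s: "\<chi> (g [^] k) = int k * s" by auto
    have gs: "[\<chi> (g [^] t) = int t * s] (mod int m)" if gt: "g [^] t \<in> H" for t :: nat
    proof -
      obtain u where "t = k * u" using dvd[OF gt] by auto
      then show ?thesis using gkt[of u] s by (simp add: mult_ac)
    qed
    obtain K \<psi> where K: "subgroup K G" "H \<subseteq> K" "g \<in> K" "character_mod m K \<psi>"
      and \<psi>: "\<forall>h\<in>H. [\<psi> h = \<chi> h] (mod int m)"
      using extend_character_by[OF fin less.prems(1,2) g(1) gs] by auto
    have KG: "K \<subseteq> carrier G" by (rule subgroup.subset[OF K(1)])
    have "card H < card K"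
      using K(2,3) g(2) finite_subset[OF KG fin] by (intro psubset_card_mono) auto
    moreover have "card K \<le> card (carrier G)" using KG fin by (rule card_mono[rotated])
    ultimately have "card (carrier G) - card K < card (carrier G) - card H" by linarith
    from less.hyps[OF this K(1,4)] obtain \<phi>
      where \<phi>: "character_mod m (carrier G) \<phi>" "\<forall>h\<in>K. [\<phi> h = \<psi> h] (mod int m)" by auto
    have "[\<phi> h = \<chi> h] (mod int m)" if "h \<in> H" for h
      using \<phi>(2) \<psi> that K(2) by (meson cong_trans subsetD)
    then show ?thesis using \<phi>(1) by auto
  qed
qed

end

section \<open>Groups with trivial exterior square are cyclic\<close>

text \<open>
  Triviality of the commutator pairing makes \<open>G\<close> abelian. Let the order \<open>m\<close> of \<open>x\<close> be the exponent of
  \<open>G\<close>, and let \<open>\<chi> : G \<rightarrow> \<int>/m\<close> be a character with \<open>\<chi> x = 1\<close>. Then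
  \<open>(g, h) \<mapsto> g^\<chi>(h) h^-\<chi>(g)\<close> is an alternating bilinear map, and its vanishing at \<open>(g, x)\<close> says
  that \<open>g = x^\<chi>(g)\<close>.
\<close>

lemma (in group) cyclic_if_wedge_trivial:
  assumes fin: "finite (carrier G)"
    and triv: "\<And>x y. x \<in> carrier G \<Longrightarrow> y \<in> carrier G \<Longrightarrow> wedge G x y = \<one>\<^bsub>exterior_square G\<^esub>"
  shows "cyclic_group G"
proof -
  interpret comm_group G
    by (rule group_comm_groupI) (rule wedge_imp_commute[OF _ _ triv])
  obtain x where x: "x \<in> carrier G" and exp: "\<And>g. g \<in> carrier G \<Longrightarrow> g [^] ord x = \<one>"
    using obtain_ord_exponent[OF fin] by blast
  let ?m = "ord x"
  have m: "?m > 0" using ord_ge_1[OF fin x] by simp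
  \<comment> \<open>On the trivial subgroup the value 1 at \<open>x\<close> is admissible, since \<open>x^t = 1\<close> only if \<open>m\<close> divides \<open>t\<close>.\<close>
  have "[(\<lambda>_. 0) (x [^] t) = int t * 1] (mod int ?m)" if "x [^] t \<in> {\<one>}" for t :: nat
    using that x by (simp add: pow_eq_id cong_0_iff cong_sym_eq[of 0])
  from extend_character_by[OF fin triv_subgroup _ x this]
  obtain K \<chi>0 where K: "subgroup K G" "x \<in> K" "character_mod ?m K \<chi>0" "[\<chi>0 x = 1] (mod int ?m)"
    by (auto simp: character_mod_def)
  obtain \<chi> where \<chi>: "character_mod ?m (carrier G) \<chi>" "\<forall>h\<in>K. [\<chi> h = \<chi>0 h] (mod int ?m)"
    using extend_character[OF fin m exp K(1,3)] by auto
  have \<chi>x: "[\<chi> x = 1] (mod int ?m)" using \<chi>(2) K(2,4) cong_trans by blast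
  have pow_cong: "g [^] i = g [^] j" if "g \<in> carrier G" "[i = j] (mod int ?m)" for g and i j :: int
  proof -
    have "ord g dvd ?m" using exp[OF that(1)] pow_eq_id[OF that(1)] by simp
    then have "int (ord g) dvd j - i"
      using that(2) by (meson cong_iff_dvd_diff cong_sym dvd_trans int_dvd_int_iff)
    then show ?thesis using that(1) by (simp add: int_pow_eq)
  qed
  let ?f = "\<lambda>g h. g [^] \<chi> h \<otimes> inv (h [^] \<chi> g)"
  have pow_chi: "k [^] \<chi> (g \<otimes> h) = k [^] \<chi> g \<otimes> k [^] \<chi> h"
    if "g \<in> carrier G" "h \<in> carrier G" "k \<in> carrier G" for g h k
    using pow_cong[of k "\<chi> (g \<otimes> h)" "\<chi> g + \<chi> h"] that \<chi>(1)
    by (simp add: character_mod_def int_pow_mult)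
  have conj: "conj_by G a b = b" if "a \<in> carrier G" "b \<in> carrier G" for a b
    using that by (simp add: conj_by_commuting m_comm)
  have "exterior_pairing G G ?f"
    by (simp add: exterior_pairing_def conj pow_chi int_pow_mult_distrib m_comm inv_mult m_ac)
  note vanish = exterior_pairing_vanishes[OF is_group is_group this _ _ triv]
  have "g = x [^] \<chi> g" if g: "g \<in> carrier G" for g
  proof -
    have "g [^] \<chi> x = x [^] \<chi> g"
      using vanish[OF g x g x] g x by (metis int_pow_closed inv_closed inv_equality inv_inv)
    then show ?thesis
      using pow_cong[OF g \<chi>x] g by (simp add: int_pow_1)
  qed
  then show ?thesis
    unfolding cyclic_group using x by (intro bexI[OF _ x]) auto
qed

section \<open>Counting tuples of pairwise related elements\<close>

lemma (in group) card_subgroup_dvd: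
  assumes H: "subgroup H G" and K: "subgroup K G" and HK: "H \<subseteq> K"
  shows "card H dvd card K"
proof -
  have "card (rcosets\<^bsub>G\<lparr>carrier := K\<rparr>\<^esub> H) * card H = card K"
    using group.lagrange[OF subgroup_imp_group[OF K] subgroup_incl[OF H K HK]] by (simp add: order_def)
  then show ?thesis by (metis dvd_triv_right)
qed

text \<open>
  The index divides the order of \<open>G\<close> and is not 1, so it has a prime factor, which is at least \<open>p\<close>.
\<close>

lemma (in group) order_mult_le_of_psubgroup:
  assumes fin: "finite (carrier G)"
    and p: "\<And>q. prime q \<Longrightarrow> q dvd order G \<Longrightarrow> p \<le> q"
    and H: "subgroup H G" and K: "subgroup K G" and HK: "H \<subset> K"
  shows "p * card H \<le> card K"
proof -
  have finK: "finite K" using subgroup.subset[OF K] fin finite_subset by blast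
  obtain c where c: "card K = card H * c"
    using card_subgroup_dvd[OF H K] HK by (auto elim: dvdE)
  have less: "card H < card K" using HK finK by (rule psubset_card_mono[rotated])
  have "c \<noteq> 1" using c less by auto
  then obtain q where q: "prime q" "q dvd c" using prime_factor_nat by blast
  have "card K dvd order G"
    using card_subgroup_dvd[OF K subgroup_self] subgroup.subset[OF K] by (simp add: order_def)
  moreover have "c dvd card K" using c by simp
  ultimately have "q dvd order G" using q(2) dvd_trans by blast
  then have "p \<le> q" by (rule p[OF q(1)])
  also have "q \<le> c" using q(2) c less by (intro dvd_imp_le) (auto intro: gr0I)
  finally show ?thesis using c by simp
qed

text \<open>
  The count uses only these properties of the exterior centralizers; they hold for ordinary
  centralizers as well, where \<open>center\<close> is the centre of the group.
\<close>

locale centralizer_family = group +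
  fixes C :: "'a \<Rightarrow> 'a set"
  assumes finite_carrier: "finite (carrier G)"
    and subgroup_C: "x \<in> carrier G \<Longrightarrow> subgroup (C x) G"
    and self_mem_C: "x \<in> carrier G \<Longrightarrow> x \<in> C x"
    and C_sym: "x \<in> carrier G \<Longrightarrow> y \<in> C x \<Longrightarrow> x \<in> C y"
begin

definition center where "center = (\<Inter>x\<in>carrier G. C x)"

definition tuples :: "nat \<Rightarrow> 'a set \<Rightarrow> (nat \<Rightarrow> 'a) set"
  where "tuples k H = {x \<in> {1..k} \<rightarrow>\<^sub>E H. \<forall>i\<in>{1..k}. \<forall>j\<in>{1..k}. x j \<in> C (x i)}"

lemma C_subset: "x \<in> carrier G \<Longrightarrow> C x \<subseteq> carrier G"
  using subgroup_C subgroup.subset by blast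

lemma subgroup_center: "subgroup center G"
  unfolding center_def using subgroup_C by (intro subgroups_Inter) auto

lemma center_subset: "center \<subseteq> carrier G"
  using subgroup_center subgroup.subset by blast

lemma center_subset_C: "x \<in> carrier G \<Longrightarrow> center \<subseteq> C x"
  by (auto simp: center_def)

lemma C_center:
  assumes "x \<in> center" shows "C x = carrier G"
proof
  show "C x \<subseteq> carrier G" using C_subset center_subset assms by blast
  show "carrier G \<subseteq> C x" using assms C_sym by (auto simp: center_def)
qed

lemma C_psubset:
  assumes "x \<in> carrier G" "x \<notin> center" shows "C x \<subset> carrier G"
proof -
  obtain y where "y \<in> carrier G" "x \<notin> C y" using assms by (auto simp: center_def)
  then show ?thesis using C_sym C_subset assms by blast
qed

lemma finite_tuples: "H \<subseteq> carrier G \<Longrightarrow> finite (tuples k H)"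
  unfolding tuples_def using finite_subset[OF _ finite_carrier]
  by (intro finite_Collect_conjI) (auto intro: finite_PiE)

lemma card_tuples_0: "card (tuples 0 H) = 1"
  by (simp add: tuples_def)

text \<open>
  Fixing the last entry \<open>y\<close> confines the others to \<open>C y\<close>.
\<close>

lemma card_tuples_Suc:
  assumes H: "H \<subseteq> carrier G"
  shows "card (tuples (Suc k) H) = (\<Sum>y\<in>H. card (tuples k (H \<inter> C y)))"
proof -
  let ?I = "{1..k}"
  have ins: "{1..Suc k} = insert (Suc k) ?I" by auto
  have undef: "x (Suc k) = undefined" if "x \<in> tuples k K" for x K
  proof -
    have "x \<in> {1..k} \<rightarrow>\<^sub>E K" using that by (simp add: tuples_def)
    then show ?thesis by (rule PiE_arb) simp
  qed
  have "bij_betw (\<lambda>(y, x). x(Suc k := y)) (SIGMA y:H. tuples k (H \<inter> C y)) (tuples (Suc k) H)"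
  proof (rule bij_betw_byWitness[where f' = "\<lambda>x. (x (Suc k), x(Suc k := undefined))"])
    show "\<forall>a\<in>SIGMA y:H. tuples k (H \<inter> C y).
        (\<lambda>x. (x (Suc k), x(Suc k := undefined))) ((\<lambda>(y, x). x(Suc k := y)) a) = a"
      using undef by (force simp: fun_eq_iff)
    show "\<forall>x\<in>tuples (Suc k) H. (\<lambda>(y, x). x(Suc k := y)) (x (Suc k), x(Suc k := undefined)) = x"
      by auto
    show "(\<lambda>(y, x). x(Suc k := y)) ` (SIGMA y:H. tuples k (H \<inter> C y)) \<subseteq> tuples (Suc k) H"
    proof safe
      fix y x assume y: "y \<in> H" and x: "x \<in> tuples k (H \<inter> C y)"
      have xi: "x i \<in> H" "x i \<in> C y" if "i \<in> ?I" for i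
        using x that by (auto simp: tuples_def)
      then have "y \<in> C (x i)" if "i \<in> ?I" for i using C_sym H y that by blast
      then show "x(Suc k := y) \<in> tuples (Suc k) H"
        using x y xi self_mem_C H unfolding tuples_def ins by (auto simp: PiE_iff extensional_def)
    qed
    show "(\<lambda>x. (x (Suc k), x(Suc k := undefined))) ` tuples (Suc k) H \<subseteq> (SIGMA y:H. tuples k (H \<inter> C y))"
      unfolding tuples_def ins by (auto simp: PiE_iff extensional_def)
  qed
  from bij_betw_same_card[OF this] show ?thesis
    using finite_tuples H finite_subset[OF H finite_carrier]
    by (subst card_SigmaI[symmetric]) (auto intro: finite_tuples)
qed

lemma card_tuples_le: "H \<subseteq> carrier G \<Longrightarrow> card (tuples k H) \<le> card H ^ k"
proof -
  assume H: "H \<subseteq> carrier G"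
  have "card (tuples k H) \<le> card ({1..k} \<rightarrow>\<^sub>E H)"
    using finite_subset[OF H finite_carrier] by (intro card_mono finite_PiE) (auto simp: tuples_def)
  then show ?thesis by (simp add: card_PiE)
qed

lemma card_tuples_split:
  "card (tuples (Suc k) (carrier G)) =
     card center * card (tuples k (carrier G)) + (\<Sum>y\<in>carrier G - center. card (tuples k (C y)))"
proof -
  have "card (tuples (Suc k) (carrier G)) = (\<Sum>y\<in>carrier G. card (tuples k (C y)))"
    by (subst card_tuples_Suc) (auto intro!: sum.cong simp: Int_absorb1 C_subset)
  also have "\<dots> = (\<Sum>y\<in>center. card (tuples k (C y))) + (\<Sum>y\<in>carrier G - center. card (tuples k (C y)))"
    using sum.subset_diff[OF center_subset finite_carrier] by (simp add: add.commute)
  also have "(\<Sum>y\<in>center. card (tuples k (C y))) = card center * card (tuples k (carrier G))"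
    by (simp add: C_center)
  finally show ?thesis .
qed

end

text \<open>
  With \<open>k = n + 1\<close> entries, this is the bound \<open>(p^(n+1) + p^n - 1) / p^(2n+1)\<close>. In this indexing the
  recursion below starts at \<open>k = 0\<close>, where the bound is 1.
\<close>

definition degree_bound :: "real \<Rightarrow> nat \<Rightarrow> real"
  where "degree_bound p k = (p ^ Suc k + p ^ k - p) / p ^ (2 * k)"

lemma degree_bound_0: "degree_bound p 0 = 1"
  by (simp add: degree_bound_def)

lemma degree_bound_Suc:
  assumes "p > 0"
  shows "degree_bound p (Suc k) = (1 / p\<^sup>2) * degree_bound p k + (1 - 1 / p\<^sup>2) * (1 / p) ^ k"
proof -
  have "p ^ (2 * k) = p ^ k * p ^ k" by (simp add: power_add mult_2)
  then show ?thesis using assms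
    by (simp add: degree_bound_def power_one_over divide_simps power2_eq_square) (simp add: algebra_simps)
qed

lemma degree_bound_ge:
  assumes "p > 1" shows "(1 / p) ^ k \<le> degree_bound p k" and "k \<ge> 1 \<Longrightarrow> (1 / p) ^ k < degree_bound p k"
proof -
  have eq: "degree_bound p k - (1 / p) ^ k = p * (p ^ k - 1) / p ^ (2 * k)"
    using assms by (simp add: degree_bound_def power_one_over field_simps power_add[symmetric] mult_2_right)
  have "p ^ k \<ge> 1" using assms by simp
  then have "degree_bound p k - (1 / p) ^ k \<ge> 0" unfolding eq using assms by simp
  then show "(1 / p) ^ k \<le> degree_bound p k" by simp
  assume "k \<ge> 1"
  then have "p ^ k > 1" using assms by (simp add: one_less_power)
  then have "degree_bound p k - (1 / p) ^ k > 0" unfolding eq using assms by simp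
  then show "(1 / p) ^ k < degree_bound p k" by simp
qed

locale proper_centralizer_family = centralizer_family +
  fixes p :: nat
  assumes prime_p: "prime p" and p_least: "prime q \<Longrightarrow> q dvd order G \<Longrightarrow> p \<le> q"
    and center_proper: "center \<noteq> carrier G"
begin

abbreviation tuple_density :: "nat \<Rightarrow> real"
  where "tuple_density k \<equiv> real (card (tuples k (carrier G))) / real (card (carrier G)) ^ k"

lemma card_carrier_pos: "card (carrier G) > 0"
  using finite_carrier one_closed by (auto simp: card_gt_0_iff)

lemma card_C_le:
  assumes "y \<in> carrier G" "y \<notin> center"
  shows "p * card (C y) \<le> card (carrier G)" "p * card center \<le> card (C y)"
proof -
  show "p * card (C y) \<le> card (carrier G)"
    by (rule order_mult_le_of_psubgroup[OF finite_carrier p_least subgroup_C subgroup_self C_psubset])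
      (use assms in auto)
  have "center \<subset> C y" using center_subset_C self_mem_C assms by blast
  from order_mult_le_of_psubgroup[OF finite_carrier p_least subgroup_center subgroup_C this]
  show "p * card center \<le> card (C y)" using assms by simp
qed

text \<open>
  Any non-central \<open>y\<close> gives the proper inclusions \<open>center < C y < G\<close>, and each index is at least the
  least prime divisor of the order.
\<close>

lemma card_center_le: "p\<^sup>2 * card center \<le> card (carrier G)"
proof -
  obtain y where y: "y \<in> carrier G" "y \<notin> center" using center_proper center_subset by blast
  have "p * (p * card center) \<le> p * card (C y)"
    using card_C_le(2)[OF y] by (rule mult_le_mono2)
  also note card_C_le(1)[OF y]
  finally show ?thesis by (simp add: power2_eq_square mult.assoc)
qed

definition center_density :: real
  where "center_density = real (card center) / real (card (carrier G))"

lemma center_density_le: "center_density \<le> 1 / (real p)\<^sup>2"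
proof -
  have "(real p)\<^sup>2 * real (card center) \<le> real (card (carrier G))"
    using card_center_le by (metis of_nat_le_iff of_nat_mult of_nat_power)
  then show ?thesis
    using card_carrier_pos prime_gt_0_nat[OF prime_p] by (simp add: center_density_def field_simps)
qed

lemma center_density_eq_iff:
  "center_density = 1 / (real p)\<^sup>2 \<longleftrightarrow> card (carrier G) = p\<^sup>2 * card center"
proof -
  have "center_density = 1 / (real p)\<^sup>2 \<longleftrightarrow> real (card (carrier G)) = real (p\<^sup>2 * card center)"
    using card_carrier_pos prime_gt_0_nat[OF prime_p]
    by (simp add: center_density_def field_simps)
  then show ?thesis by (simp only: of_nat_eq_iff)
qed

lemma tuple_density_Suc:
  "tuple_density (Suc k) = center_density * tuple_density k +
     (\<Sum>y\<in>carrier G - center. real (card (tuples k (C y)))) / real (card (carrier G)) ^ Suc k"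
  by (simp add: card_tuples_split center_density_def add_divide_distrib)

lemma card_diff_center:
  "real (card (carrier G - center)) = (1 - center_density) * real (card (carrier G))"
  using card_carrier_pos card_mono[OF finite_carrier center_subset] finite_subset[OF center_subset finite_carrier]
  by (simp add: card_Diff_subset center_subset center_density_def of_nat_diff field_simps)

text \<open>
  A central last entry puts no condition on the first \<open>k\<close>; a non-central one confines them to a
  proper subgroup, of index at least \<open>p\<close>.
\<close>

lemma tuple_density_Suc_le: "tuple_density (Suc k) \<le> center_density * tuple_density k + (1 - center_density) * (1 / real p) ^ k"
proof -
  let ?N = "real (card (carrier G))"
  have N: "?N > 0" using card_carrier_pos by simp
  have "real (card (tuples k (C y))) \<le> (?N / real p) ^ k" if "y \<in> carrier G - center" for y
  proof -
    have "real (card (tuples k (C y))) \<le> real (card (C y)) ^ k"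
      using card_tuples_le[OF C_subset] that by (metis DiffD1 of_nat_le_iff of_nat_power)
    also have "real p * real (card (C y)) \<le> ?N"
      using card_C_le(1)[of y] that by (metis DiffD1 DiffD2 of_nat_le_iff of_nat_mult)
    then have "real (card (C y)) \<le> ?N / real p"
      using prime_gt_0_nat[OF prime_p] by (simp add: field_simps)
    then have "real (card (C y)) ^ k \<le> (?N / real p) ^ k" by (intro power_mono) auto
    finally show ?thesis .
  qed
  then have "(\<Sum>y\<in>carrier G - center. real (card (tuples k (C y)))) \<le> real (card (carrier G - center)) * (?N / real p) ^ k"
    by (rule sum_bounded_above)
  then have "(\<Sum>y\<in>carrier G - center. real (card (tuples k (C y)))) / ?N ^ Suc k
      \<le> real (card (carrier G - center)) * (?N / real p) ^ k / ?N ^ Suc k"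
    using N by (intro divide_right_mono) auto
  also have "\<dots> = (1 - center_density) * (1 / real p) ^ k"
    using N by (simp add: card_diff_center power_divide)
  finally show ?thesis unfolding tuple_density_Suc by simp
qed

text \<open>
  Replacing the density \<open>z\<close> of the centre by its largest possible value \<open>1/p^2\<close> gives the recursion
  of the bound, and does not decrease the convex combination, as \<open>p^-k\<close> is the smaller of its two terms.
  For \<open>k = 0\<close> both terms are 1 and nothing is gained, which is why strictness needs \<open>k \<ge> 1\<close>.
\<close>

lemma convex_step:
  fixes z :: real
  assumes "z \<le> 1 / (real p)\<^sup>2"
  shows "z * degree_bound p k + (1 - z) * (1 / real p) ^ k \<le> degree_bound p (Suc k)"
    and "z < 1 / (real p)\<^sup>2 \<Longrightarrow> k \<ge> 1 \<Longrightarrow>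
      z * degree_bound p k + (1 - z) * (1 / real p) ^ k < degree_bound p (Suc k)"
proof -
  have p: "real p > 1" using prime_gt_1_nat[OF prime_p] by simp
  have eq: "degree_bound p (Suc k) - (z * degree_bound p k + (1 - z) * (1 / real p) ^ k) =
      (1 / (real p)\<^sup>2 - z) * (degree_bound p k - (1 / real p) ^ k)"
    using p by (simp add: degree_bound_Suc algebra_simps)
  have "(1 / (real p)\<^sup>2 - z) * (degree_bound p k - (1 / real p) ^ k) \<ge> 0"
    using degree_bound_ge(1)[OF p] assms by (intro mult_nonneg_nonneg) auto
  then show "z * degree_bound p k + (1 - z) * (1 / real p) ^ k \<le> degree_bound p (Suc k)"
    using eq by linarith
  assume "z < 1 / (real p)\<^sup>2" "k \<ge> 1"
  then have "(1 / (real p)\<^sup>2 - z) * (degree_bound p k - (1 / real p) ^ k) > 0"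
    using degree_bound_ge(2)[OF p] by (intro mult_pos_pos) auto
  then show "z * degree_bound p k + (1 - z) * (1 / real p) ^ k < degree_bound p (Suc k)"
    using eq by linarith
qed

lemma tuple_density_le: "tuple_density k \<le> degree_bound p k"
proof (induction k)
  case 0
  then show ?case by (simp add: card_tuples_0 degree_bound_0)
next
  case (Suc k)
  have "center_density \<ge> 0" by (simp add: center_density_def)
  then have "tuple_density (Suc k) \<le> center_density * degree_bound p k + (1 - center_density) * (1 / real p) ^ k"
    using tuple_density_Suc_le[of k] mult_left_mono[OF Suc] by (meson order_trans add_right_mono)
  also have "\<dots> \<le> degree_bound p (Suc k)" by (rule convex_step(1)[OF center_density_le])
  finally show ?case .
qed

lemma tuple_density_less:
  assumes "center_density < 1 / (real p)\<^sup>2" "k \<ge> 1"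
  shows "tuple_density (Suc k) < degree_bound p (Suc k)"
proof -
  have "center_density \<ge> 0" by (simp add: center_density_def)
  then have "tuple_density (Suc k) \<le> center_density * degree_bound p k + (1 - center_density) * (1 / real p) ^ k"
    using tuple_density_Suc_le[of k] mult_left_mono[OF tuple_density_le[of k]] by (meson order_trans add_right_mono)
  also have "\<dots> < degree_bound p (Suc k)"
    using convex_step(2)[OF center_density_le assms] .
  finally show ?thesis .
qed

text \<open>
  When the centre has index \<open>p^2\<close>, both estimates of the recursion are sharp: for non-central \<open>y\<close>
  the subgroup \<open>C y\<close> has index exactly \<open>p\<close>, and all tuples in it are counted, since for non-central
  \<open>u \<in> C y\<close> the subgroup \<open>C u \<inter> C y\<close> lies strictly above the centre and so fills \<open>C y\<close>.
\<close>

lemma tuple_density_eq: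
  assumes N: "card (carrier G) = p\<^sup>2 * card center"
  shows "tuple_density k = degree_bound p k"
proof (induction k)
  case 0
  then show ?case by (simp add: card_tuples_0 degree_bound_0)
next
  case (Suc k)
  let ?N = "real (card (carrier G))"
  have p0: "p > 0" using prime_gt_0_nat[OF prime_p] .
  have "real (card (tuples k (C y))) = (?N / real p) ^ k" if y: "y \<in> carrier G - center" for y
  proof -
    have yG: "y \<in> carrier G" "y \<notin> center" using y by auto
    have finC: "finite (C y)" using C_subset yG finite_carrier finite_subset by blast
    have card_C: "card (C y) = p * card center"
      using card_C_le[OF yG] p0 by (simp add: N power2_eq_square)
    have all: "v \<in> C u" if u: "u \<in> C y" and v: "v \<in> C y" for u v
    proof (cases "u \<in> center")
      case True
      then show ?thesis using C_center C_subset v yG by blast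
    next
      case False
      have uG: "u \<in> carrier G" using u C_subset yG by blast
      have sub: "subgroup (C u \<inter> C y) G"
        using subgroup_C yG uG by (intro subgroups_Inter_pair) auto
      have "center \<subset> C u \<inter> C y"
        using center_subset_C uG yG self_mem_C[OF uG] u False by blast
      from order_mult_le_of_psubgroup[OF finite_carrier p_least subgroup_center sub this]
      have "card (C y) \<le> card (C u \<inter> C y)" by (simp add: card_C)
      then have "C u \<inter> C y = C y" using finC by (intro card_seteq) auto
      then show ?thesis using v by blast
    qed
    have "tuples k (C y) = {1..k} \<rightarrow>\<^sub>E C y"
      unfolding tuples_def using all by (auto simp: PiE_mem)
    then have "card (tuples k (C y)) = card (C y) ^ k" by (simp add: card_PiE)
    moreover have "?N / real p = real (card (C y))"
      using p0 by (simp add: N card_C power2_eq_square)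
    ultimately show ?thesis by simp
  qed
  then have "(\<Sum>y\<in>carrier G - center. real (card (tuples k (C y)))) = real (card (carrier G - center)) * (?N / real p) ^ k"
    by simp
  then have "tuple_density (Suc k) = center_density * tuple_density k + (1 - center_density) * (1 / real p) ^ k"
    unfolding tuple_density_Suc using card_carrier_pos by (simp add: card_diff_center power_divide)
  also have "\<dots> = degree_bound p (Suc k)"
    using Suc p0 center_density_eq_iff N by (simp add: degree_bound_Suc)
  finally show ?case .
qed

theorem tuple_density_eq_iff:
  assumes "k \<ge> 1"
  shows "tuple_density (Suc k) = degree_bound p (Suc k) \<longleftrightarrow> card (carrier G) = p\<^sup>2 * card center"
  using tuple_density_eq[of "Suc k"] tuple_density_less[OF _ assms] center_density_le center_density_eq_iff by fastforce

end

section \<open>Groups of order \<open>p^2\<close>\<close>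

context group
begin

lemma prime_order_subgroups_disjoint:
  assumes A: "subgroup A G" and B: "subgroup B G" and "prime (card A)" "card B = card A" "A \<noteq> B"
  shows "A \<inter> B = {\<one>}"
proof -
  have fin: "finite A" "finite B" using assms by (auto intro: card_ge_0_finite simp: prime_gt_0_nat)
  have "card (A \<inter> B) dvd card A"
    using A B by (intro card_subgroup_dvd subgroups_Inter_pair) auto
  then consider "card (A \<inter> B) = 1" | "card (A \<inter> B) = card A"
    using assms(3) by (auto simp: prime_nat_iff)
  then show ?thesis
  proof cases
    case 1
    then obtain a where "A \<inter> B = {a}" by (auto simp: card_1_singleton_iff)
    moreover have "\<one> \<in> A \<inter> B" using A B by (simp add: subgroup.one_closed)
    ultimately show ?thesis by auto
  next
    case 2
    then have "A \<inter> B = A" using fin by (intro card_subset_eq) auto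
    moreover have "A \<inter> B = B" using 2 fin assms(4) by (intro card_subset_eq) auto
    ultimately show ?thesis using assms by simp
  qed
qed

text \<open>
  The multiplication map from \<open>A \<times> B\<close> is injective, and \<open>A \<times> B\<close> has as many elements
  as the group.
\<close>

lemma set_mult_prime_order_subgroups:
  assumes A: "subgroup A G" "card A = p" and B: "subgroup B G" "card B = p" and "A \<noteq> B"
    and p: "prime p" and order: "order G = p\<^sup>2"
  shows "A <#> B = carrier G"
proof -
  interpret group_disjoint_sum G A B using A B by (simp add: group_disjoint_sum_def is_group)
  have "A \<inter> B \<subseteq> {\<one>}"
    using prime_order_subgroups_disjoint[OF A(1) B(1)] assms by simp
  then have "inj_on (\<lambda>(a, b). a \<otimes> b) (A \<times> B)"
    unfolding cancel by (auto simp: inj_on_def)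
  then have "card ((\<lambda>(a, b). a \<otimes> b) ` (A \<times> B)) = p\<^sup>2"
    using A B by (simp add: card_image card_cartesian_product power2_eq_square)
  moreover have "A <#> B = (\<lambda>(a, b). a \<otimes> b) ` (A \<times> B)" by (auto simp: set_mult_def)
  moreover have "finite (carrier G)"
    using order prime_gt_0_nat[OF p] by (intro card_ge_0_finite) (simp add: order_def)
  ultimately show ?thesis
    using setmult_subset_G[OF AG.subset BG.subset] order by (intro card_subset_eq) (auto simp: order_def)
qed

text \<open>
  A proper subgroup \<open>A\<close> never satisfies \<open>G = A (g A g\<inverse>)\<close>: writing \<open>g\<inverse> = b (g c g\<inverse>)\<close> with
  \<open>b, c \<in> A\<close> gives \<open>g = b\<inverse> c\<inverse> \<in> A\<close>. So \<open>A\<close> cannot differ from any of its conjugates.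
\<close>

lemma normal_if_prime_order:
  assumes A: "subgroup A G" "card A = p" and p: "prime p" and order: "order G = p\<^sup>2"
  shows "A \<lhd> G"
proof (rule normal_invI[OF A(1)])
  fix g a assume g: "g \<in> carrier G" and a: "a \<in> A"
  interpret A: subgroup A G by (rule A)
  interpret conj: group_hom G G "conj_by G g"
    using g by unfold_locales (auto simp: hom_def conj_by_closed conj_by_mult)
  let ?B = "conj_by G g ` A"
  have "inj_on (conj_by G g) A"
    using g by (auto simp: inj_on_def conj_by_def A.mem_carrier)
  then have B: "subgroup ?B G" "card ?B = p"
    using A conj.subgroup_img_is_subgroup by (auto simp: card_image)
  have "A = ?B"
  proof (rule ccontr)
    assume "A \<noteq> ?B"
    from set_mult_prime_order_subgroups[OF A B this p order]
    have "inv g \<in> A <#> ?B" using g by simp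
    then obtain b c where bc: "b \<in> A" "c \<in> A" "inv g = b \<otimes> (g \<otimes> c \<otimes> inv g)"
      by (auto simp: set_mult_def conj_by_def)
    have bcG: "b \<in> carrier G" "c \<in> carrier G" using bc by (auto simp: A.mem_carrier)
    have "inv g = (b \<otimes> g \<otimes> c) \<otimes> inv g" using bc(3) bcG g by (simp add: m_assoc)
    then have "b \<otimes> g \<otimes> c = inv g \<otimes> g"
      using inv_solve_right[of "inv g" "b \<otimes> g \<otimes> c" g] bcG g by simp
    then have "b \<otimes> (g \<otimes> c) = \<one>" using bcG g by (simp add: m_assoc)
    then have "g \<otimes> c = inv b"
      using inv_solve_left[of "g \<otimes> c" b \<one>] bcG g by simp
    then have "g = inv b \<otimes> inv c"
      using inv_solve_right[of g "inv b" c] bcG g by simp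
    then have "g \<in> A" using bc by simp
    then have "?B \<subseteq> A" by (auto simp: conj_by_def)
    then have "?B = A"
      using A B prime_gt_0_nat[OF p] by (intro card_subset_eq) (auto intro: card_ge_0_finite)
    then show False using \<open>A \<noteq> ?B\<close> by simp
  qed
  then show "g \<otimes> a \<otimes> inv g \<in> A" using a unfolding conj_by_def by blast
qed

lemma ord_eq_prime:
  assumes p: "prime p" and order: "order G = p\<^sup>2" and nc: "\<not> cyclic_group G"
    and x: "x \<in> carrier G" "x \<noteq> \<one>"
  shows "ord x = p"
proof -
  have fin: "finite (carrier G)"
    using order prime_gt_0_nat[OF p] by (intro card_ge_0_finite) (simp add: order_def)
  have "ord x dvd p\<^sup>2" using ord_dvd_group_order[OF x(1)] order by simp
  then obtain i where i: "i \<le> 2" "ord x = p ^ i" using divides_primepow_nat[OF p] by blast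
  moreover have "i \<noteq> 0"
    using ord_eq_1[OF x(1)] x(2) i(2) by (intro notI) simp
  moreover have "i \<noteq> 2"
  proof
    assume "i = 2"
    then have "card (generate G {x}) = card (carrier G)"
      using i order generate_pow_card[OF x(1)] by (simp add: order_def)
    then have "generate G {x} = carrier G"
      using fin x by (intro card_subset_eq) (auto simp: generate_incl)
    then have "carrier G = range (\<lambda>n::int. x [^] n)"
      using generate_pow[OF x(1)] by (simp add: full_SetCompr_eq)
    then show False using nc x(1) unfolding cyclic_group by blast
  qed
  ultimately have "i = 1" by linarith
  then show ?thesis using i by simp
qed

text \<open>
  Every non-trivial element has order \<open>p\<close>. Two elements \<open>x\<close> and \<open>y\<close> that generate different
  subgroups commute, as these subgroups are normal and meet trivially, and the powers of \<open>x\<close> and \<open>y\<close>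
  are coordinates on \<open>G\<close>.
\<close>

lemma elementary_abelian_if_order_prime_square:
  assumes p: "prime p" and order: "order G = p\<^sup>2" and nc: "\<not> cyclic_group G"
  shows "elementary_abelian p 2 G"
proof -
  have p0: "p > 0" by (rule prime_gt_0_nat[OF p])
  have gen: "subgroup (generate G {z}) G" "card (generate G {z}) = p"
    if "z \<in> carrier G" "z \<noteq> \<one>" for z
    using that generate_is_subgroup[of "{z}"] generate_pow_card[of z] ord_eq_prime[OF p order nc] by auto
  have "card (carrier G) > 1"
    using order one_less_power[OF prime_gt_1_nat[OF p], of 2] by (simp add: order_def)
  then have "carrier G \<noteq> {\<one>}" by auto
  then obtain x where x: "x \<in> carrier G" "x \<noteq> \<one>" using one_closed by blast
  let ?A = "generate G {x}"
  have "card ?A < card (carrier G)"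
    using gen(2)[OF x] order prime_gt_1_nat[OF p] by (simp add: order_def power2_eq_square)
  then have "?A \<noteq> carrier G" by auto
  moreover have "?A \<subseteq> carrier G" using generate_incl x by auto
  ultimately obtain y where y: "y \<in> carrier G" "y \<notin> ?A" by blast
  have y1: "y \<noteq> \<one>" using y(2) generate.one by blast
  let ?B = "generate G {y}"
  have "y \<in> ?B" by (simp add: generate.incl)
  then have AB: "?A \<noteq> ?B" using y by blast
  note A = gen[OF x] and B = gen[OF y(1) y1]
  have comm: "a \<otimes> b = b \<otimes> a" if "a \<in> ?A" "b \<in> ?B" for a b
    using normal_imp_commuting[OF normal_if_prime_order[OF A p order] normal_if_prime_order[OF B p order] _ that]
      prime_order_subgroups_disjoint[OF A(1) B(1) _ _ AB] A B p by simp
  have powA: "x [^] (i::int) \<in> ?A" and powB: "y [^] (i::int) \<in> ?B" for i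
    using generate_pow x y by auto
  have pow_mod: "z [^] (i mod int p) = z [^] i" if "z \<in> carrier G" "z \<noteq> \<one>" for z and i :: int
    using that ord_eq_prime[OF p order nc that] by (simp add: int_pow_eq mod_eq_dvd_iff[symmetric])
  let ?P = "product_group {..<2::nat} (\<lambda>_. integer_mod_group p)"
  let ?f = "\<lambda>v. x [^] (v 0 :: int) \<otimes> y [^] (v (1::nat) :: int)"
  have hom: "?f \<in> hom ?P G"
  proof (rule homI)
    fix v w :: "nat \<Rightarrow> int"
    have "?f (v \<otimes>\<^bsub>?P\<^esub> w) = x [^] (v 0 + w 0) \<otimes> y [^] (v 1 + w 1)"
      using x y y1 by (simp add: pow_mod)
    also have "\<dots> = x [^] v 0 \<otimes> (x [^] w 0 \<otimes> y [^] v 1) \<otimes> y [^] w 1"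
      using x y by (simp add: int_pow_mult m_assoc)
    also have "\<dots> = x [^] v 0 \<otimes> (y [^] v 1 \<otimes> x [^] w 0) \<otimes> y [^] w 1"
      by (simp only: comm[OF powA powB])
    also have "\<dots> = ?f v \<otimes> ?f w"
      using x y by (simp add: m_assoc)
    finally show "?f (v \<otimes>\<^bsub>?P\<^esub> w) = ?f v \<otimes> ?f w" .
  qed (use x y in auto)
  have "carrier G \<subseteq> ?f ` carrier ?P"
  proof
    fix g assume "g \<in> carrier G"
    then have "g \<in> ?A <#> ?B" using set_mult_prime_order_subgroups[OF A B AB p order] by simp
    then obtain i j :: int where g: "g = x [^] i \<otimes> y [^] j"
      using x y by (auto simp: set_mult_def generate_pow)
    let ?v = "\<lambda>k\<in>{..<2::nat}. if k = 0 then i mod int p else j mod int p"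
    have "g = ?f ?v" using x y y1 by (simp add: g pow_mod)
    moreover have "?v \<in> carrier ?P" using p0 by (auto simp: carrier_integer_mod_group)
    ultimately show "g \<in> ?f ` carrier ?P" by blast
  qed
  then have surj: "?f ` carrier ?P = carrier G" using hom by (auto simp: hom_def)
  have "card (carrier ?P) = p\<^sup>2"
    using p0 by (simp add: card_PiE carrier_integer_mod_group)
  moreover have "finite (carrier ?P)"
    using p0 by (auto simp: carrier_integer_mod_group intro: finite_PiE)
  ultimately have "inj_on ?f (carrier ?P)"
    using surj order by (intro eq_card_imp_inj_on) (simp_all add: order_def)
  then have "?f \<in> iso ?P G" using hom surj by (simp add: iso_def bij_betw_def)
  then have "G \<cong> ?P"
    using group.iso_sym[of ?P G] by (auto simp: is_iso_def)
  then show ?thesis unfolding elementary_abelian_def .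
qed

end

lemma card_elementary_abelian:
  assumes "p > 0" "elementary_abelian p r G"
  shows "order G = p ^ r"
proof -
  have "order G = order (product_group {..<r} (\<lambda>_. integer_mod_group p))"
    using assms(2) iso_same_order by (auto simp: elementary_abelian_def is_iso_def)
  then show ?thesis
    using assms(1) by (simp add: order_def card_PiE carrier_integer_mod_group)
qed

section \<open>The multiple exterior degree\<close>

lemma (in group) mem_exterior_center_iff:
  assumes "x \<in> carrier G"
  shows "x \<in> exterior_center G \<longleftrightarrow> carrier G \<subseteq> exterior_centralizer G x"
  using assms wedge_sym by (auto simp: exterior_center_def exterior_centralizer_def)

text \<open>
  If the quotient is generated by the class of \<open>x\<close>, then the exterior centralizer of \<open>x\<close> contains
  both the exterior center and the powers of \<open>x\<close>, which together make up \<open>G\<close>. So \<open>x\<close> lies in the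
  exterior center, and then so does everything else.
\<close>

lemma (in group) cyclic_mod_exterior_center:
  assumes cyc: "cyclic_group (G Mod exterior_center G)"
  shows "exterior_center G = carrier G"
proof -
  let ?Z = "exterior_center G"
  interpret Z: normal ?Z G by (rule normal_exterior_center)
  interpret Q: group "G Mod ?Z" by (rule Z.factorgroup_is_group)
  obtain x where x: "x \<in> carrier G"
    and gen: "carrier (G Mod ?Z) = range (\<lambda>n::int. (?Z #> x) [^]\<^bsub>G Mod ?Z\<^esub> n)"
    using cyc unfolding Q.cyclic_group by (auto simp: carrier_FactGroup)
  have split: "\<exists>z\<in>?Z. \<exists>n::int. g = z \<otimes> x [^] n" if g: "g \<in> carrier G" for g
  proof -
    have "?Z #> g \<in> carrier (G Mod ?Z)" using g by (simp add: carrier_FactGroup)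
    then obtain n :: int where "?Z #> g = ?Z #> x [^] n"
      using gen Z.FactGroup_int_pow[OF x] by auto
    then have "g \<in> ?Z #> x [^] n" using rcos_self[OF g Z.subgroup_axioms] by simp
    then show ?thesis by (auto simp: r_coset_def)
  qed
  note C = subgroup_exterior_centralizer[OF x]
  have "x \<in> exterior_centralizer G x"
    unfolding exterior_centralizer_def using x wedge_self[OF x] by (intro CollectI conjI)
  from subgroup_int_pow_closed[OF C this]
  have pow: "x [^] n \<in> exterior_centralizer G x" for n :: int .
  have "g \<in> exterior_centralizer G x" if g: "g \<in> carrier G" for g
  proof -
    obtain z and n :: int where z: "z \<in> ?Z" and g_eq: "g = z \<otimes> x [^] n"
      using split[OF g] by (elim bexE exE)
    have "z \<in> exterior_centralizer G x" using z x unfolding exterior_center_def by (rule INT_D)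
    then show ?thesis unfolding g_eq by (rule subgroup.m_closed[OF C _ pow])
  qed
  then have "x \<in> ?Z"
    unfolding mem_exterior_center_iff[OF x] by (rule subsetI)
  then have pow: "x [^] n \<in> ?Z" for n :: int
    by (rule subgroup_int_pow_closed[OF Z.subgroup_axioms])
  have "g \<in> ?Z" if "g \<in> carrier G" for g
    using split[OF that] Z.m_closed[OF _ pow] by (elim bexE exE) (simp only:)
  then show ?thesis using exterior_center_subset by blast
qed

theorem theorem3p7:
  fixes G :: "('a, 'b) monoid_scheme" and p n :: nat
  assumes "group G"
    and "finite (carrier G)"
    and "\<not> cyclic_group G"
    and "prime p" and "p dvd order G"
    and "\<And>q. prime q \<Longrightarrow> q dvd order G \<Longrightarrow> p \<le> q"
    and "n \<ge> 1"
  shows "multiple_exterior_degree n G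
           \<le> (real p ^ (n + 1) + real p ^ n - 1) / real p ^ (2 * n + 1)
       \<and> (multiple_exterior_degree n G
           = (real p ^ (n + 1) + real p ^ n - 1) / real p ^ (2 * n + 1)
         \<longleftrightarrow> elementary_abelian p 2 (G Mod exterior_center G))"
proof -
  interpret group G by fact
  let ?Z = "exterior_center G"
  have p0: "p > 0" using \<open>prime p\<close> by (rule prime_gt_0_nat)
  interpret fam: centralizer_family G "exterior_centralizer G"
  proof (intro centralizer_family.intro centralizer_family_axioms.intro is_group)
    show "finite (carrier G)" by fact
    show "subgroup (exterior_centralizer G x) G" if "x \<in> carrier G" for x
      by (rule subgroup_exterior_centralizer[OF that])
    show "x \<in> exterior_centralizer G x" if "x \<in> carrier G" for x
      unfolding exterior_centralizer_def using that wedge_self[OF that] by (intro CollectI conjI)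
    show "x \<in> exterior_centralizer G y" if "x \<in> carrier G" "y \<in> exterior_centralizer G x" for x y
      using that wedge_sym[of x y] unfolding exterior_centralizer_def by blast
  qed
  have Z: "fam.center = ?Z" by (simp add: fam.center_def exterior_center_def)
  have proper: "?Z \<noteq> carrier G"
  proof
    assume "?Z = carrier G"
    then have "wedge G x y = \<one>\<^bsub>exterior_square G\<^esub>" if "x \<in> carrier G" "y \<in> carrier G" for x y
      using that by (auto simp: exterior_center_def exterior_centralizer_def)
    then show False using cyclic_if_wedge_trivial assms(2,3) by blast
  qed
  interpret fam: proper_centralizer_family G "exterior_centralizer G" p
    using assms(4,6) proper by unfold_locales (auto simp: Z)
  have "fam.tuples (n + 1) (carrier G) =
      {x \<in> {1..n+1} \<rightarrow>\<^sub>E carrier G.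
        \<forall>i\<in>{1..n+1}. \<forall>j\<in>{1..n+1}. wedge G (x i) (x j) = \<one>\<^bsub>exterior_square G\<^esub>}"
    unfolding fam.tuples_def exterior_centralizer_def by (auto simp: PiE_mem)
  then have degree: "multiple_exterior_degree n G = fam.tuple_density (Suc n)"
    by (simp add: multiple_exterior_degree_def)
  have bound: "(real p ^ (n + 1) + real p ^ n - 1) / real p ^ (2 * n + 1) = degree_bound p (Suc n)"
    using p0 by (simp add: degree_bound_def field_simps)
  interpret Z: normal ?Z G by (rule normal_exterior_center)
  interpret Q: group "G Mod ?Z" by (rule Z.factorgroup_is_group)
  have "order (G Mod ?Z) * card ?Z = card (carrier G)"
    using lagrange[OF Z.subgroup_axioms] by (simp add: order_def FactGroup_def)
  moreover have "card ?Z > 0"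
    using finite_subset[OF exterior_center_subset assms(2)] subgroup.one_closed[OF Z.subgroup_axioms]
    by (metis card_gt_0_iff empty_iff)
  ultimately have "card (carrier G) = p\<^sup>2 * card fam.center \<longleftrightarrow> order (G Mod ?Z) = p\<^sup>2"
    unfolding Z by (metis mult_cancel2 less_irrefl)
  also have "\<dots> \<longleftrightarrow> elementary_abelian p 2 (G Mod ?Z)"
    using Q.elementary_abelian_if_order_prime_square[OF \<open>prime p\<close>] cyclic_mod_exterior_center proper
      card_elementary_abelian[OF p0] by blast
  finally show ?thesis
    unfolding degree bound using fam.tuple_density_le[of "Suc n"] fam.tuple_density_eq_iff[OF \<open>n \<ge> 1\<close>] by simp
qed

end
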